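(* Let $T$ be a semistandard shifted tableau of straight shape $\lambda$ and let $\overline y$ be a high letter. Then the mixed insertion of $\overline y$ into $T$ equals $\mathrm{rect}_{\mathrm{mix}}(T\oplus\overline y)$.
   Context: A strict partition $\theta=(\theta_1>\dots>\theta_k>0)$ is identified with its shifted Young diagram: row $i$ consists of the cells $(i,j)$ with $i\le j\le i+\theta_i-1$ (English convention, row 1 on top). For strict partitions $\mu\subseteq\nu$, the skew shape $\nu/\mu$ is the set of cells of $\nu$ not in $\mu$. A cell $(i,i)$ is diagonal. For a cell $\mathsf b=(i,j)$ write $\mathsf b^{\uparrow}=(i-1,j)$, $\mathsf b^{\leftarrow}=(i,j-1)$, $\mathsf b^{\downarrow}=(i+1,j)$, $\mathsf b^{\uparrow\leftarrow}=(i-1,j-1)$. Alphabet: for each positive integer $i$ there is a low letter $\underline{i}$ and a high letter $\overline{\imath}$, ordered $\underline1<\overline1<\underline2<\overline2<\cdots$. Raising means replacing $\underline i$ by $\overline\imath$; lowering the reverse. A semistandard (shifted) tableau of shape $\nu/\mu$ is a filling of the cells of $\nu/\mu$ with such letters so that rows weakly increase left to right, columns weakly increase top to bottom, no diagonal cell contains a low letter, each column contains at most one copy of each high letter, and each row contains at most one copy of each low letter. Straight shape means $\mu=\emptyset$. $T\oplus\overline y$: if $T$ has straight shape $\lambda=(\lambda_1,\dots,\lambda_\ell)$, this is the tableau of skew shape $(\lambda_1+1,\lambda_1,\lambda_2,\dots,\lambda_\ell)/(\lambda_1)$ whose entry in cell $(1,\lambda_1+1)$ is $\overline y$ and whose entry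 in cell $(i+1,j+1)$ is the entry of $T$ in cell $(i,j)$ (a copy of $T$ placed one row down and one column right, with $\overline y$ at the end of the new first row). Mixed insertion of a high letter $\overline x$ into $T$ (Haiman): insert $\overline x$ into row 1. Inserting a letter $z$ into a row (resp. column): if $z$ is weakly greater than all entries of that row (resp. column), place $z$ in the next cell at the end of that row (resp. column) and stop; otherwise $z$ replaces the least entry $w$ of the row (resp. column) strictly greater than $z$, and $w$ is bumped. If $w$ is high and was not bumped from a diagonal cell, $w$ is next inserted into the row below the row of the cell it was bumped from; otherwise (i.e. $w$ is low, or $w$ was bumped from a diagonal cell) the low letter with the same underlying integer as $w$ is next inserted into the column to the right of the cell it was bumped from. The final tableau is the mixed insertion of $\overline x$ into $T$. Mixed rectification of a semistandard tableau $S$ of shape $\nu/\mu$: a tableau with holes allows additionally a symbol $\bullet$. Place a $\bullet$ in every cell of the bottom row of $\mu$. Bullets are swapped with entries by mixed slides, and a bullet is deleted as soon as there is no entry of the tableau to its southeast. An entry $y$ in cell $\mathsf b$ is available if $\mathsf b^\uparrow$ or $\mathsf b^\leftarrow$ contains a $\bullet$. Available entries are ordered by the letter order, ties broken so that among equal low letters the northmost is least and among equal high letters the westmost is least. Let $y\in\mathsf b$ be the least available entry and apply the unique applicable slide from the first of the collections (R1)–(R6) in which some slide applies (a cell vacated by an entry receives a $\bullet$): (R1) if $\mathsf b^\uparrow,\mathsf b^\leftarrow,\mathsf b^{\uparrow\leftarrow}$ all contain $\bullet$, move $y$ to $\mathsf b^{\uparrow\leftarrow}$; or if $\mathsf b$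 is diagonal and $\mathsf b^\uparrow,\mathsf b^{\uparrow\leftarrow}$ contain $\bullet$, move $y$ to $\mathsf b^{\uparrow\leftarrow}$. (R2) if $\mathsf b^{\uparrow\leftarrow}$ contains an entry $x$ and $\mathsf b^\uparrow,\mathsf b^\leftarrow$ contain $\bullet$: if $y$ is low and $x\ne y$, move $y$ to $\mathsf b^\uparrow$; if $y$ is high and $x\neq y$, move $y$ to $\mathsf b^\leftarrow$. (R3) if $\mathsf b^\leftarrow$ is diagonal, $\mathsf b^{\uparrow\leftarrow}$ and the cell left of it contain entries, $\mathsf b^\uparrow,\mathsf b^\leftarrow$ contain $\bullet$ and $y$ is low, raise $y$ and move it to $\mathsf b^\leftarrow$; or if $\mathsf b^{\uparrow\leftarrow}$ contains an entry, $\mathsf b^\uparrow,\mathsf b^\leftarrow$ contain $\bullet$ and $y$ is low, move $y$ to $\mathsf b^\leftarrow$; or in the same situation with $y$ high, move $y$ to $\mathsf b^\uparrow$. (R4) if $y=\underline k$, $\mathsf b^\leftarrow$ is diagonal and contains $\bullet$, and the diagonal cell $\mathsf b^\downarrow$ contains $\overline k$: put $\overline k$ in $\mathsf b^\leftarrow$ and in $\mathsf b$, and $\bullet$ in $\mathsf b^\downarrow$. (R5) if $\mathsf b^\leftarrow$ is diagonal and contains $\bullet$ and $\mathsf b^\downarrow$ is a cell, raise $y$ and move it to $\mathsf b^\leftarrow$; or if $\mathsf b$ is diagonal, $y$ is high, $\mathsf b^\uparrow$ contains $\bullet$ and $\mathsf b^{\uparrow\leftarrow}$ contains an entry, lower $y$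 and move it to $\mathsf b^\uparrow$. (R6) if $\mathsf b^\leftarrow$ contains $\bullet$, move $y$ to $\mathsf b^\leftarrow$; if $\mathsf b^\uparrow$ contains $\bullet$, move $y$ to $\mathsf b^\uparrow$. Repeat with the new least available entry until no entry is available; the result has some shape $\nu'/\mu'$. Then place bullets in the bottom row of $\mu'$ and repeat, until a tableau of straight shape is obtained; this is $\mathrm{rect}_{\mathrm{mix}}(S)$.
   Formalization: The formal theorem also assumes that T⊕ȳ is semistandard (λ is empty, or ȳ is strictly less than the last entry of row 1 of T); otherwise rect_mix(T⊕ȳ) is undefined, and the slides can give another tableau, e.g. for T the single cell 1̄ and ȳ = 2̄. *)

theory Defs
  imports Main "HOL-Library.While_Combinator" "HOL-Library.Product_Lexorder"
begin

text \<open>Lo i is the low letter underline-i, Hi i the high letter overline-i.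
  Order: Lo 1 < Hi 1 < Lo 2 < Hi 2 < ... realised through the injective key.\<close>

datatype letter = Lo nat | Hi nat

fun key :: "letter \<Rightarrow> nat" where
  "key (Lo i) = 2 * i"
| "key (Hi i) = 2 * i + 1"

fun idx :: "letter \<Rightarrow> nat" where
  "idx (Lo i) = i"
| "idx (Hi i) = i"

fun is_high :: "letter \<Rightarrow> bool" where
  "is_high (Lo _) = False"
| "is_high (Hi _) = True"

definition is_low :: "letter \<Rightarrow> bool" where
  "is_low a \<longleftrightarrow> \<not> is_high a"

definition lless :: "letter \<Rightarrow> letter \<Rightarrow> bool" where
  "lless a b \<longleftrightarrow> key a < key b"

definition raise :: "letter \<Rightarrow> letter" where
  "raise a = Hi (idx a)"

definition lower :: "letter \<Rightarrow> letter" where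
  "lower a = Lo (idx a)"

definition strict_part :: "nat list \<Rightarrow> bool" where
  "strict_part lam \<longleftrightarrow> sorted_wrt (>) lam \<and> (\<forall>x\<in>set lam. 0 < x)"

definition shdiag :: "nat list \<Rightarrow> (nat \<times> nat) set" where
  "shdiag lam = {(i,j). 1 \<le> i \<and> i \<le> length lam \<and> i \<le> j \<and> j < i + lam ! (i - 1)}"

type_synonym tab = "nat \<times> nat \<Rightarrow> letter option"

definition semistandard :: "nat list \<Rightarrow> nat list \<Rightarrow> tab \<Rightarrow> bool" where
  "semistandard nu mu T \<longleftrightarrow>
     strict_part nu \<and> strict_part mu \<and> shdiag mu \<subseteq> shdiag nu \<and>
     dom T = shdiag nu - shdiag mu \<and>
     (\<forall>c a. T c = Some a \<longrightarrow> 1 \<le> idx a) \<and>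
     (\<forall>i j j' a b. T (i,j) = Some a \<longrightarrow> T (i,j') = Some b \<longrightarrow> j < j' \<longrightarrow> key a \<le> key b) \<and>
     (\<forall>i i' j a b. T (i,j) = Some a \<longrightarrow> T (i',j) = Some b \<longrightarrow> i < i' \<longrightarrow> key a \<le> key b) \<and>
     (\<forall>i a. T (i,i) = Some a \<longrightarrow> is_high a) \<and>
     (\<forall>i i' j k. T (i,j) = Some (Hi k) \<longrightarrow> T (i',j) = Some (Hi k) \<longrightarrow> i = i') \<and>
     (\<forall>i j j' k. T (i,j) = Some (Lo k) \<longrightarrow> T (i,j') = Some (Lo k) \<longrightarrow> j = j')"

definition first_part :: "nat list \<Rightarrow> nat" where
  "first_part lam = (case lam of [] \<Rightarrow> 0 | a # _ \<Rightarrow> a)"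

definition oplus_inner :: "nat list \<Rightarrow> nat list" where
  "oplus_inner lam = (if first_part lam = 0 then [] else [first_part lam])"

definition oplus_outer :: "nat list \<Rightarrow> nat list" where
  "oplus_outer lam = (first_part lam + 1) # lam"

definition oplus :: "nat list \<Rightarrow> tab \<Rightarrow> nat \<Rightarrow> tab" where
  "oplus lam T y = (\<lambda>(i,j). if (i,j) = (1, first_part lam + 1) then Some (Hi y)
                            else if 2 \<le> i \<and> 2 \<le> j then T (i - 1, j - 1) else None)"

datatype act = RowIns nat letter | ColIns nat letter

fun ins_step :: "tab \<times> act option \<Rightarrow> tab \<times> act option" where
  "ins_step (T, None) = (T, None)"
| "ins_step (T, Some (RowIns r z)) =
     (let J = {j. (r,j) \<in> dom T};
          G = {j \<in> J. lless z (the (T (r,j)))}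
      in if G = {} then (T((r, if J = {} then r else Max J + 1) := Some z), None)
         else
           (let m = Min ((\<lambda>j. key (the (T (r,j)))) ` G);
                j0 = Min {j \<in> G. key (the (T (r,j))) = m};
                w = the (T (r,j0))
            in (T((r,j0) := Some z),
                Some (if is_high w \<and> j0 \<noteq> r then RowIns (r + 1) w
                      else ColIns (j0 + 1) (Lo (idx w))))))"
| "ins_step (T, Some (ColIns c z)) =
     (let I = {i. (i,c) \<in> dom T};
          G = {i \<in> I. lless z (the (T (i,c)))}
      in if G = {} then (T((if I = {} then 1 else Max I + 1, c) := Some z), None)
         else
           (let m = Min ((\<lambda>i. key (the (T (i,c)))) ` G);
                i0 = Min {i \<in> G. key (the (T (i,c))) = m};
                w = the (T (i0,c))
            in (T((i0,c) := Some z),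
                Some (if is_high w \<and> i0 \<noteq> c then RowIns (i0 + 1) w
                      else ColIns (c + 1) (Lo (idx w))))))"

definition mixed_insert :: "tab \<Rightarrow> nat \<Rightarrow> tab option" where
  "mixed_insert T x =
     map_option fst (while_option (\<lambda>s. snd s \<noteq> None) ins_step (T, Some (RowIns 1 (Hi x))))"

datatype hcell = Bul | Ent letter

type_synonym htab = "nat \<times> nat \<Rightarrow> hcell option"

definition up :: "nat \<times> nat \<Rightarrow> nat \<times> nat" where "up b = (fst b - 1, snd b)"
definition lft :: "nat \<times> nat \<Rightarrow> nat \<times> nat" where "lft b = (fst b, snd b - 1)"
definition dwn :: "nat \<times> nat \<Rightarrow> nat \<times> nat" where "dwn b = (fst b + 1, snd b)"
definition upl :: "nat \<times> nat \<Rightarrow> nat \<times> nat" where "upl b = (fst b - 1, snd b - 1)"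
definition diag :: "nat \<times> nat \<Rightarrow> bool" where "diag b \<longleftrightarrow> fst b = snd b"

definition isB :: "htab \<Rightarrow> nat \<times> nat \<Rightarrow> bool" where "isB H c \<longleftrightarrow> H c = Some Bul"

definition entry :: "htab \<Rightarrow> nat \<times> nat \<Rightarrow> letter option" where
  "entry H c = (case H c of Some (Ent l) \<Rightarrow> Some l | _ \<Rightarrow> None)"

definition isE :: "htab \<Rightarrow> nat \<times> nat \<Rightarrow> bool" where "isE H c \<longleftrightarrow> entry H c \<noteq> None"

definition available :: "htab \<Rightarrow> nat \<times> nat \<Rightarrow> bool" where
  "available H b \<longleftrightarrow> isE H b \<and> (isB H (up b) \<or> isB H (lft b))"

definition rank :: "nat \<times> nat \<Rightarrow> letter \<Rightarrow> nat \<times> nat \<times> nat" where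
  "rank b y = (if is_high y then (key y, snd b, fst b) else (key y, fst b, snd b))"

definition cell_of_rank :: "nat \<times> nat \<times> nat \<Rightarrow> nat \<times> nat" where
  "cell_of_rank r = (case r of (k, a, c) \<Rightarrow> if even k then (a, c) else (c, a))"

definition least_avail :: "htab \<Rightarrow> nat \<times> nat" where
  "least_avail H = cell_of_rank (Min ((\<lambda>b. rank b (the (entry H b))) ` {b. available H b}))"

definition mv :: "htab \<Rightarrow> nat \<times> nat \<Rightarrow> nat \<times> nat \<Rightarrow> letter \<Rightarrow> htab" where
  "mv H b c l = H(b := Some Bul, c := Some (Ent l))"

definition slide :: "htab \<Rightarrow> nat \<times> nat \<Rightarrow> letter \<Rightarrow> htab" where
  "slide H b y =
    (let u = up b; l = lft b; ul = upl b in
     if (isB H u \<and> isB H l \<and> isB H ul) \<or> (diag b \<and> isB H u \<and> isB H ul) then mv H b ul y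
     else if (\<exists>x. entry H ul = Some x \<and> x \<noteq> y) \<and> isB H u \<and> isB H l then
       (if is_low y then mv H b u y else mv H b l y)
     else if diag l \<and> isE H ul \<and> isE H (lft ul) \<and> isB H u \<and> isB H l \<and> is_low y then
       mv H b l (raise y)
     else if isE H ul \<and> isB H u \<and> isB H l \<and> is_low y then mv H b l y
     else if isE H ul \<and> isB H u \<and> isB H l \<and> is_high y then mv H b u y
     else if is_low y \<and> diag l \<and> isB H l \<and> diag (dwn b) \<and> entry H (dwn b) = Some (Hi (idx y)) then
       H(l := Some (Ent (Hi (idx y))), b := Some (Ent (Hi (idx y))), dwn b := Some Bul)
     else if diag l \<and> isB H l \<and> dwn b \<in> dom H then mv H b l (raise y)
     else if diag b \<and> is_high y \<and> isB H u \<and> isE H ul then mv H b u (lower y)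
     else if isB H l then mv H b l y
     else if isB H u then mv H b u y
     else H)"

definition clean :: "htab \<Rightarrow> htab" where
  "clean H = (\<lambda>c. if H c = Some Bul \<and>
                     \<not> (\<exists>c'. c' \<noteq> c \<and> fst c \<le> fst c' \<and> snd c \<le> snd c' \<and> isE H c')
                  then None else H c)"

definition has_bullets :: "htab \<Rightarrow> bool" where
  "has_bullets H \<longleftrightarrow> (\<exists>c. H c = Some Bul)"

definition place_bullets :: "nat list \<Rightarrow> htab \<Rightarrow> htab" where
  "place_bullets mu H =
     (let k = length mu in
      (\<lambda>c. if fst c = k \<and> k \<le> snd c \<and> snd c < k + last mu then Some Bul else H c))"

definition rect_cond :: "nat list \<times> htab \<Rightarrow> bool" where
  "rect_cond s \<longleftrightarrow> {b. available (snd s) b} \<noteq> {} \<or> (fst s \<noteq> [] \<and> \<not> has_bullets (snd s))"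

definition rect_step :: "nat list \<times> htab \<Rightarrow> nat list \<times> htab" where
  "rect_step s = (case s of (mu, H) \<Rightarrow>
     if {b. available H b} \<noteq> {} then
       (let b = least_avail H in (mu, clean (slide H b (the (entry H b)))))
     else (butlast mu, clean (place_bullets mu H)))"

definition rect_mix :: "nat list \<Rightarrow> tab \<Rightarrow> tab option" where
  "rect_mix mu S =
     (case while_option rect_cond rect_step (mu, (\<lambda>c. map_option Ent (S c))) of
        None \<Rightarrow> None
      | Some (mu', H) \<Rightarrow> if has_bullets H then None else Some (entry H))"

end

theory Submission
  imports Defs
begin

text \<open>
  Both procedures are compared while the cells of \<open>T\<close> are added one at a time in the order
  in which rectification treats them; the set \<open>D\<close> of cells treated so far is an order ideal.
  Let \<open>I\<close> be the insertion of \<open>y\<close> into the restriction of \<open>T\<close> to \<open>D\<close>, and let \<open>p\<close> be the cell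
  in which this insertion ended. When all letters up to \<open>y\<close> have been treated, the tableau with
  holes consists of \<open>I\<close>, of the entries of \<open>T\<close> outside \<open>D\<close> in their shifted positions, and of
  bullets in the gaps. The next entry \<open>z\<close>, from cell \<open>e\<close> of \<open>T\<close>, is at least as large as all of
  \<open>I\<close>. If \<open>e \<noteq> p\<close>, then insertion does not notice \<open>z\<close>, and rectification moves it diagonally
  back to \<open>e\<close>. If \<open>e = p\<close>, then insertion bumps \<open>z\<close> to the end of the next row or, lowered if
  necessary, of the next column, and rectification slides it to that same place because the
  diagonal way is blocked. Only (R1), (R2), (R5) and (R6) ever occur.
\<close>

declare split_paired_All [simp del] split_paired_Ex [simp del]

section \<open>Order ideals in the shifted quarter plane\<close>

definition valid :: "(nat \<times> nat) set" where
  "valid = {(i,j). 1 \<le> i \<and> i \<le> j}"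

definition nw :: "nat \<times> nat \<Rightarrow> nat \<times> nat \<Rightarrow> bool" where
  "nw c c' \<longleftrightarrow> fst c \<le> fst c' \<and> snd c \<le> snd c'"

definition ideal :: "(nat \<times> nat) set \<Rightarrow> bool" where
  "ideal D \<longleftrightarrow> D \<subseteq> valid \<and> (\<forall>c\<in>D. \<forall>c'\<in>valid. nw c' c \<longrightarrow> c' \<in> D)"

lemma idealD: "ideal D \<Longrightarrow> c \<in> D \<Longrightarrow> c' \<in> valid \<Longrightarrow> nw c' c \<Longrightarrow> c' \<in> D"
  by (auto simp: ideal_def)

lemma ideal_Un: "ideal D \<Longrightarrow> ideal E \<Longrightarrow> ideal (D \<union> E)"
  by (auto simp: ideal_def)

lemma key_inject: "key a = key b \<Longrightarrow> a = b"
  by (cases a; cases b) (auto, presburger+)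

subsection \<open>Mixed insertion\<close>

fun on_line :: "act \<Rightarrow> nat \<times> nat \<Rightarrow> bool" where
  "on_line (RowIns r z) c \<longleftrightarrow> fst c = r"
| "on_line (ColIns k z) c \<longleftrightarrow> snd c = k"

fun act_letter :: "act \<Rightarrow> letter" where
  "act_letter (RowIns r z) = z"
| "act_letter (ColIns k z) = z"

fun line_end :: "(nat \<times> nat) set \<Rightarrow> act \<Rightarrow> nat \<times> nat" where
  "line_end D (RowIns r z) = (let J = {j. (r,j) \<in> D} in (r, if J = {} then r else Max J + 1))"
| "line_end D (ColIns k z) = (let I = {i. (i,k) \<in> D} in (if I = {} then 1 else Max I + 1, k))"

definition bump_act :: "nat \<times> nat \<Rightarrow> letter \<Rightarrow> act" where
  "bump_act c w = (if is_high w \<and> fst c \<noteq> snd c then RowIns (fst c + 1) w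
                   else ColIns (snd c + 1) (Lo (idx w)))"

definition fits :: "tab \<Rightarrow> act \<Rightarrow> bool" where
  "fits U a \<longleftrightarrow> (\<forall>c x. U c = Some x \<longrightarrow> on_line a c \<longrightarrow> key x \<le> key (act_letter a))"

text \<open>On a single line \<open>nw\<close> compares the one free coordinate, so the last clause
  reproduces both nested minima of \<open>ins_step\<close>: the least key, then the first
  position.\<close>

definition bumps :: "tab \<Rightarrow> act \<Rightarrow> nat \<times> nat \<Rightarrow> letter \<Rightarrow> bool" where
  "bumps U a c w \<longleftrightarrow> U c = Some w \<and> on_line a c \<and> key (act_letter a) < key w \<and>
     (\<forall>c' x. U c' = Some x \<longrightarrow> on_line a c' \<longrightarrow> key (act_letter a) < key x \<longrightarrow>
        key w < key x \<or> (key w = key x \<and> nw c c'))"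

lemma ins_step_fits:
  assumes "fits U a"
  shows "ins_step (U, Some a) = (U(line_end (dom U) a \<mapsto> act_letter a), None)"
proof (cases a)
  case (RowIns r z)
  then have "{j \<in> {j. (r,j) \<in> dom U}. lless z (the (U (r,j)))} = {}"
    using assms by (fastforce simp: fits_def lless_def)
  then show ?thesis using RowIns by (simp add: Let_def)
next
  case (ColIns k z)
  then have "{i \<in> {i. (i,k) \<in> dom U}. lless z (the (U (i,k)))} = {}"
    using assms by (fastforce simp: fits_def lless_def)
  then show ?thesis using ColIns by (simp add: Let_def)
qed

lemma ins_step_bumps:
  assumes "finite (dom U)" "bumps U a c w"
  shows "ins_step (U, Some a) = (U(c \<mapsto> act_letter a), Some (bump_act c w))"
proof (cases a)
  case (RowIns r z)
  define G where "G = {j \<in> {j. (r,j) \<in> dom U}. lless z (the (U (r,j)))}"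
  obtain j0 where c: "c = (r,j0)" using assms(2) RowIns by (cases c) (auto simp: bumps_def)
  have "G \<subseteq> snd ` dom U" by (force simp: G_def image_iff)
  then have fin: "finite G" using assms(1) by (meson finite_imageI finite_subset)
  have j0: "j0 \<in> G" using assms(2) RowIns c by (auto simp: G_def bumps_def lless_def)
  have U: "U (r,j0) = Some w" using assms(2) c by (auto simp: bumps_def)
  have le: "key w < key (the (U (r,j))) \<or> key w = key (the (U (r,j))) \<and> j0 \<le> j" if "j \<in> G" for j
    using assms(2) RowIns c that by (fastforce simp: G_def bumps_def lless_def nw_def)
  have m: "Min ((\<lambda>j. key (the (U (r,j)))) ` G) = key w"
    by (rule Min_eqI) (use fin j0 U le in \<open>force+\<close>)
  have M: "Min {j \<in> G. key (the (U (r,j))) = key w} = j0"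
    by (rule Min_eqI) (use fin j0 U le in \<open>force+\<close>)
  show ?thesis using RowIns c m M U j0
    unfolding RowIns ins_step.simps Let_def G_def[symmetric] by (auto simp: bump_act_def)
next
  case (ColIns k z)
  define G where "G = {i \<in> {i. (i,k) \<in> dom U}. lless z (the (U (i,k)))}"
  obtain i0 where c: "c = (i0,k)" using assms(2) ColIns by (cases c) (auto simp: bumps_def)
  have "G \<subseteq> fst ` dom U" by (force simp: G_def image_iff)
  then have fin: "finite G" using assms(1) by (meson finite_imageI finite_subset)
  have i0: "i0 \<in> G" using assms(2) ColIns c by (auto simp: G_def bumps_def lless_def)
  have U: "U (i0,k) = Some w" using assms(2) c by (auto simp: bumps_def)
  have le: "key w < key (the (U (i,k))) \<or> key w = key (the (U (i,k))) \<and> i0 \<le> i" if "i \<in> G" for i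
    using assms(2) ColIns c that by (fastforce simp: G_def bumps_def lless_def nw_def)
  have m: "Min ((\<lambda>i. key (the (U (i,k)))) ` G) = key w"
    by (rule Min_eqI) (use fin i0 U le in \<open>force+\<close>)
  have M: "Min {i \<in> G. key (the (U (i,k))) = key w} = i0"
    by (rule Min_eqI) (use fin i0 U le in \<open>force+\<close>)
  show ?thesis using ColIns c m M U i0
    unfolding ColIns ins_step.simps Let_def G_def[symmetric] by (auto simp: bump_act_def)
qed

text \<open>A relational form of the loop that also returns the cell \<open>p\<close> filled last.
  Derivations are finite, so termination is part of the statement.\<close>

inductive runs :: "tab \<Rightarrow> act \<Rightarrow> tab \<Rightarrow> nat \<times> nat \<Rightarrow> bool" where
  place: "fits U a \<Longrightarrow> p = line_end (dom U) a \<Longrightarrow> runs U a (U(p \<mapsto> act_letter a)) p"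
| bump: "bumps U a c w \<Longrightarrow> runs (U(c \<mapsto> act_letter a)) (bump_act c w) I p \<Longrightarrow> runs U a I p"

lemma bumps_dom: "bumps U a c w \<Longrightarrow> dom (U(c \<mapsto> x)) = dom U"
  by (auto simp: bumps_def)

lemma runs_while:
  "runs U a I p \<Longrightarrow> finite (dom U) \<Longrightarrow>
   while_option (\<lambda>s. snd s \<noteq> None) ins_step (U, Some a) = Some (I, None)"
proof (induction rule: runs.induct)
  case (place U a p)
  \<comment> \<open>The loop is unfolded twice: once to place the letter, once to see that no action
    is left.\<close>
  then show ?case
    by (subst while_option_unfold, simp only: ins_step_fits, subst while_option_unfold, simp)
next
  case (bump U a c w I p)
  then show ?case
    by (subst while_option_unfold, simp only: ins_step_bumps bumps_dom, simp)
qed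

lemma key_bump_act: "key (act_letter (bump_act c w)) \<le> key w"
  by (cases w) (auto simp: bump_act_def)

lemma runs_bound:
  "runs U a I p \<Longrightarrow> \<forall>c x. U c = Some x \<longrightarrow> key x \<le> K \<Longrightarrow> key (act_letter a) \<le> K \<Longrightarrow>
   I c = Some x \<Longrightarrow> key x \<le> K"
proof (induction arbitrary: c x rule: runs.induct)
  case (place U a p)
  then show ?case by (auto split: if_splits)
next
  case (bump U a c' w I p)
  have "key (act_letter (bump_act c' w)) \<le> K"
    using bump.hyps bump.prems key_bump_act[of c' w] by (fastforce simp: bumps_def)
  moreover have "\<forall>c x. (U(c' \<mapsto> act_letter a)) c = Some x \<longrightarrow> key x \<le> K"
    using bump.prems by auto
  ultimately show ?case using bump by blast
qed

text \<open>Each row of an ideal is an interval starting on the diagonal and each column one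
  starting in row 1, so an addable cell of a line is the cell after its last one. An empty line
  gives the defaults \<open>r\<close> and \<open>1\<close> of \<open>line_end\<close>.\<close>

lemma line_end_eqI:
  assumes "ideal D" "ideal (insert e D)" "e \<notin> D" "on_line a e"
  shows "line_end D a = e"
proof (cases a)
  case (RowIns r z)
  then obtain j where e: "e = (r,j)" using assms(4) by (cases e) auto
  have v: "1 \<le> r" "r \<le> j" using assms(2) e by (auto simp: ideal_def valid_def)
  have "{j. (r,j) \<in> D} = {r..<j}"
  proof (intro set_eqI iffI)
    fix j' assume "j' \<in> {j. (r,j) \<in> D}"
    then have "(r,j') \<in> D" by simp
    moreover from this have "r \<le> j'" using assms(1) by (auto simp: ideal_def valid_def)
    moreover have "\<not> j \<le> j'"
      using idealD[OF assms(1) \<open>(r,j') \<in> D\<close>, of "(r,j)"] v e assms(3) by (auto simp: valid_def nw_def)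
    ultimately show "j' \<in> {r..<j}" by simp
  next
    fix j' assume "j' \<in> {r..<j}"
    then show "j' \<in> {j. (r,j) \<in> D}"
      using idealD[OF assms(2), of e "(r,j')"] v e by (auto simp: valid_def nw_def)
  qed
  moreover have "Max {r..<j} = j - 1" if "r < j"
    by (rule Max_eqI) (use that in auto)
  ultimately show ?thesis using RowIns e v by (auto simp: Let_def)
next
  case (ColIns k z)
  then obtain i where e: "e = (i,k)" using assms(4) by (cases e) auto
  have v: "1 \<le> i" "i \<le> k" using assms(2) e by (auto simp: ideal_def valid_def)
  have "{i. (i,k) \<in> D} = {1..<i}"
  proof (intro set_eqI iffI)
    fix i' assume "i' \<in> {i. (i,k) \<in> D}"
    then have "(i',k) \<in> D" by simp
    moreover from this have "1 \<le> i'" using assms(1) by (auto simp: ideal_def valid_def)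
    moreover have "\<not> i \<le> i'"
      using idealD[OF assms(1) \<open>(i',k) \<in> D\<close>, of "(i,k)"] v e assms(3) by (auto simp: valid_def nw_def)
    ultimately show "i' \<in> {1..<i}" by simp
  next
    fix i' assume "i' \<in> {1..<i}"
    then show "i' \<in> {i. (i,k) \<in> D}"
      using idealD[OF assms(2), of e "(i',k)"] v e by (auto simp: valid_def nw_def)
  qed
  moreover have "Max {1..<i} = i - 1" if "1 < i"
    by (rule Max_eqI) (use that in auto)
  ultimately show ?thesis using ColIns e v by (auto simp: Let_def)
qed

text \<open>The corner \<open>e\<close> comes after \<open>c\<close> on a common line and
  \<open>z\<close> is at least \<open>w\<close>, so even a tie is decided in favour of
  \<open>c\<close>.\<close>

lemma bumps_upd:
  assumes "bumps U a c w" "ideal (dom U)" "ideal (insert e (dom U))" "e \<notin> dom U"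
    and "\<forall>c x. U c = Some x \<longrightarrow> key x \<le> key z"
  shows "bumps (U(e \<mapsto> z)) a c w"
proof -
  have "nw c e" if "on_line a e"
  proof (rule ccontr)
    assume "\<not> nw c e"
    with that assms(1) have "nw e c" by (cases a) (auto simp: bumps_def nw_def)
    then show False
      using assms(1,3,4) idealD[OF assms(2), of c e] by (auto simp: bumps_def ideal_def)
  qed
  moreover have "key w \<le> key z" "c \<noteq> e" using assms by (auto simp: bumps_def)
  ultimately show ?thesis using assms(1) unfolding bumps_def by auto
qed

text \<open>A new maximal entry \<open>z\<close> in a corner \<open>e\<close> changes the run only if the run ends in \<open>e\<close>;
  then it goes on by bumping \<open>z\<close>.\<close>

lemma runs_upd:
  assumes "runs U a I p" "ideal (dom U)" "ideal (insert e (dom U))" "e \<notin> dom U"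
    and "\<forall>c x. U c = Some x \<longrightarrow> key x \<le> key z" "key (act_letter a) \<le> key z"
  shows "if p \<noteq> e then runs (U(e \<mapsto> z)) a (I(e \<mapsto> z)) p
    else key (the (I e)) < key z \<longrightarrow>
      (\<forall>I' q. runs I (bump_act e z) I' q \<longrightarrow> runs (U(e \<mapsto> z)) a I' q)"
  using assms
proof (induction rule: runs.induct)
  case (place U a p)
  show ?case
  proof (cases "on_line a e")
    case True
    then have p: "p = e" using place line_end_eqI by auto
    \<comment> \<open>Everything older on the line fits, so \<open>z\<close> is the only letter that
      can be bumped; overwriting it with the inserted letter gives exactly the old result
      \<open>I\<close>.\<close>
    have "bumps (U(e \<mapsto> z)) a e z" if "key (act_letter a) < key z"
      using that place.hyps(1) True unfolding bumps_def fits_def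
      by (auto simp: nw_def dest: leD)
    then show ?thesis using p runs.bump by fastforce
  next
    case False
    have eq: "{j. (r,j) \<in> dom (U(e \<mapsto> z))} = {j. (r,j) \<in> dom U}" if "r \<noteq> fst e" for r
      using that by auto
    have eq': "{i. (i,k) \<in> dom (U(e \<mapsto> z))} = {i. (i,k) \<in> dom U}" if "k \<noteq> snd e" for k
      using that by auto
    have le: "line_end (dom (U(e \<mapsto> z))) a = p"
      using False place.hyps(2) eq eq' by (cases a) (auto simp: Let_def)
    have "on_line a p" using place.hyps(2) by (cases a) (auto simp: Let_def)
    then have "p \<noteq> e" using False by auto
    moreover have "fits (U(e \<mapsto> z)) a" using place.hyps(1) False by (auto simp: fits_def)
    ultimately show ?thesis using runs.place[of "U(e \<mapsto> z)" a p] le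
      by (simp add: fun_upd_twist)
  qed
next
  case (bump U a c w I p)
  have d: "dom (U(c \<mapsto> act_letter a)) = dom U" using bump.hyps bumps_dom by blast
  have b: "bumps (U(e \<mapsto> z)) a c w"
    using bumps_upd[OF bump.hyps(1)] bump.prems by blast
  have "c \<noteq> e" using bump.hyps bump.prems by (auto simp: bumps_def)
  have "key (act_letter (bump_act c w)) \<le> key z"
    using bump.hyps bump.prems key_bump_act[of c w] by (fastforce simp: bumps_def)
  moreover have "\<forall>c' x. (U(c \<mapsto> act_letter a)) c' = Some x \<longrightarrow> key x \<le> key z"
    using bump.prems by auto
  ultimately have "if p \<noteq> e then runs (U(c \<mapsto> act_letter a, e \<mapsto> z)) (bump_act c w) (I(e \<mapsto> z)) p
    else key (the (I e)) < key z \<longrightarrow>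
      (\<forall>I' q. runs I (bump_act e z) I' q \<longrightarrow> runs (U(c \<mapsto> act_letter a, e \<mapsto> z)) (bump_act c w) I' q)"
    using bump.IH bump.prems unfolding d by blast
  moreover have "runs (U(e \<mapsto> z)) a I' q"
    if "runs (U(c \<mapsto> act_letter a, e \<mapsto> z)) (bump_act c w) I' q" for I' q
    using runs.bump[OF b] that \<open>c \<noteq> e\<close> fun_upd_twist[of c e U] by metis
  ultimately show ?case by metis
qed

subsection \<open>Mixed slides\<close>

text \<open>States of the rectification are encoded by their entries alone: cleaning keeps bullets
  only where an entry lies to the southeast, and by \<open>clean_mv\<close> all such empty cells
  still carry one after a move.\<close>

definition bulleted :: "tab \<Rightarrow> htab" where
  "bulleted L c = (case L c of Some l \<Rightarrow> Some (Ent l)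
     | None \<Rightarrow> if c \<in> valid \<and> (\<exists>c'\<in>dom L. c' \<noteq> c \<and> nw c c') then Some Bul else None)"

lemma entry_bulleted: "entry (bulleted L) = L"
  by (auto simp: entry_def bulleted_def split: option.splits)

lemma isE_bulleted: "isE (bulleted L) c \<longleftrightarrow> c \<in> dom L"
  by (auto simp: isE_def entry_bulleted)

lemma isB_bulleted:
  "isB (bulleted L) c \<longleftrightarrow> c \<notin> dom L \<and> c \<in> valid \<and> (\<exists>c'\<in>dom L. c' \<noteq> c \<and> nw c c')"
  by (auto simp: isB_def bulleted_def split: option.splits)

text \<open>The entry moves northwest, and whatever is northwest of \<open>c\<close> is also
  northwest of \<open>b\<close>. So no empty cell other than \<open>b\<close> newly requires a
  bullet.\<close>

lemma clean_mv:
  assumes "b \<in> dom L" "b \<in> valid" "c \<in> valid" "c \<notin> dom L" "nw c b"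
  shows "clean (mv (bulleted L) b c l) = bulleted (L(b := None, c \<mapsto> l))"
proof
  fix d
  let ?L = "L(b := None, c \<mapsto> l)"
  have E: "isE (mv (bulleted L) b c l) c' \<longleftrightarrow> c' \<in> dom ?L" for c'
    by (auto simp: isE_def entry_def mv_def bulleted_def split: option.splits)
  have nw: "(\<exists>c'. c' \<noteq> d \<and> fst d \<le> fst c' \<and> snd d \<le> snd c' \<and> c' \<in> dom ?L) \<longleftrightarrow>
      (\<exists>c'\<in>dom ?L. c' \<noteq> d \<and> nw d c')"
    unfolding nw_def by blast
  have none: "\<not> (\<exists>c'\<in>dom ?L. c' \<noteq> d \<and> nw d c')"
    if "\<not> (\<exists>c'\<in>dom L. c' \<noteq> d \<and> nw d c')" "d \<noteq> b" "d \<noteq> c"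
  proof
    assume "\<exists>c'\<in>dom ?L. c' \<noteq> d \<and> nw d c'"
    then obtain c' where c': "c' \<in> dom ?L" "c' \<noteq> d" "nw d c'" by blast
    with that have "c' = c" by (auto split: if_splits)
    with c' assms(5) have "nw d b" by (auto simp: nw_def)
    with that(1,2) assms(1) show False by metis
  qed
  show "clean (mv (bulleted L) b c l) d = bulleted ?L d"
  proof (cases "d = c \<or> d = b")
    case True
    then show ?thesis unfolding clean_def E nw
      using assms by (auto simp: mv_def bulleted_def)
  next
    case False
    then show ?thesis unfolding clean_def E nw
      using none assms by (auto simp: mv_def bulleted_def split: option.splits)
  qed
qed

text \<open>The inner shape is empty or a single row, so once its bullets are placed the list is
  \<open>[]\<close>. Equations between values of this loop stand for sequences of slides;
  termination is read off from the last state.\<close>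

abbreviation slides :: "htab \<Rightarrow> (nat list \<times> htab) option" where
  "slides H \<equiv> while_option rect_cond rect_step ([], H)"

lemma cell_of_rank: "cell_of_rank (rank c x) = c"
  by (cases x) (auto simp: cell_of_rank_def rank_def)

text \<open>The cells of \<open>A\<close> have come to rest: no bullet ever enters an order ideal of entries.\<close>

definition front :: "tab \<Rightarrow> (nat \<times> nat) set \<Rightarrow> nat \<times> nat \<Rightarrow> letter \<Rightarrow> bool" where
  "front M A b z \<longleftrightarrow> finite (dom M) \<and> dom M \<subseteq> valid \<and> ideal A \<and> A \<subseteq> dom M \<and>
     b \<in> valid \<and> b \<notin> dom M \<and> (\<forall>c x. M c = Some x \<longrightarrow> c \<notin> A \<longrightarrow> rank b z < rank c x)"

text \<open>The upper and left neighbours of a cell of \<open>A\<close> lie in \<open>A\<close> or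
  are no cells at all.\<close>

lemma not_available_ideal:
  assumes "ideal A" "A \<subseteq> dom L" "c \<in> A"
  shows "\<not> available (bulleted L) c"
proof -
  have "up c \<in> A" if "up c \<in> valid"
    using idealD[OF assms(1,3) that] by (simp add: nw_def up_def)
  moreover have "lft c \<in> A" if "lft c \<in> valid"
    using idealD[OF assms(1,3) that] by (simp add: nw_def lft_def)
  ultimately show ?thesis using assms(2) by (auto simp: available_def isB_bulleted)
qed

text \<open>Available cells lie outside \<open>A\<close>, where \<open>front\<close> gives all other
  entries a larger rank than \<open>z\<close>. So \<open>b\<close> is the least available cell,
  whichever others are available.\<close>

lemma slides_slide:
  assumes "front M A b z"
    and "isB (bulleted (M(b \<mapsto> z))) (up b) \<or> isB (bulleted (M(b \<mapsto> z))) (lft b)"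
  shows "slides (bulleted (M(b \<mapsto> z))) = slides (clean (slide (bulleted (M(b \<mapsto> z))) b z))"
proof -
  let ?H = "bulleted (M(b \<mapsto> z))"
  let ?R = "(\<lambda>c. rank c (the (entry ?H c))) ` {c. available ?H c}"
  have b: "available ?H b" using assms(2) by (simp add: available_def isE_bulleted)
  have sub: "{c. available ?H c} \<subseteq> dom (M(b \<mapsto> z)) - A"
    using assms(1) not_available_ideal[of A "M(b \<mapsto> z)"]
    by (fastforce simp: available_def isE_bulleted front_def)
  have "finite ?R"
    using assms(1) finite_subset[OF sub] by (simp add: front_def)
  moreover have "rank b z \<le> r" if "r \<in> ?R" for r
    using that sub assms(1) unfolding front_def entry_bulleted
    by (fastforce intro: less_imp_le split: if_splits)
  moreover have "rank b z \<in> ?R" using b by (force simp: entry_bulleted)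
  ultimately have "Min ?R = rank b z" by (intro Min_eqI) auto
  then have "least_avail ?H = b" by (simp add: least_avail_def cell_of_rank)
  then have "rect_step ([], ?H) = ([], clean (slide ?H b z))"
    using b by (auto simp: rect_step_def entry_bulleted)
  moreover have "rect_cond ([], ?H)" using b by (auto simp: rect_cond_def)
  ultimately show ?thesis by (subst while_option_unfold) simp
qed

lemma bulleted_isB:
  "c \<in> valid \<Longrightarrow> c \<notin> dom M \<Longrightarrow> c \<noteq> b \<Longrightarrow> nw c b \<Longrightarrow> isB (bulleted (M(b \<mapsto> z))) c"
  by (auto simp: isB_bulleted)

text \<open>\<open>M\<close> is the tableau without the moving letter, so a slide only changes the
  cell and the letter with which \<open>M\<close> is updated.\<close>

lemma slides_mv:
  assumes "front M A b z" "slide (bulleted (M(b \<mapsto> z))) b z = mv (bulleted (M(b \<mapsto> z))) b c l"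
    and "isB (bulleted (M(b \<mapsto> z))) (up b) \<or> isB (bulleted (M(b \<mapsto> z))) (lft b)"
    and "c \<in> valid" "c \<notin> dom M" "c \<noteq> b" "nw c b"
  shows "slides (bulleted (M(b \<mapsto> z))) = slides (bulleted (M(c \<mapsto> l)))"
proof -
  have "(M(b \<mapsto> z))(b := None, c \<mapsto> l) = M(c \<mapsto> l)"
    using assms(1) by (auto simp: front_def fun_eq_iff)
  then show ?thesis
    using slides_slide[OF assms(1,3)] assms clean_mv[of b "M(b \<mapsto> z)" c l]
    by (auto simp: front_def)
qed

text \<open>Rule (R1). For \<open>i = j\<close> the left neighbour is not a valid cell, and the
  second clause, for a diagonal cell, applies.\<close>

lemma slides_diagonal:
  assumes "front M A (i + 1, j + 1) z" "(i,j) \<in> valid"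
    and "(i,j) \<notin> dom M" "(i, j + 1) \<notin> dom M" "(i + 1, j) \<notin> dom M"
  shows "slides (bulleted (M((i + 1, j + 1) \<mapsto> z))) = slides (bulleted (M((i,j) \<mapsto> z)))"
proof (rule slides_mv[OF assms(1)])
  let ?H = "bulleted (M((i + 1, j + 1) \<mapsto> z))"
  have B: "isB ?H (i,j)" "isB ?H (i, j + 1)" "i < j \<Longrightarrow> isB ?H (i + 1, j)"
    using assms by (auto intro!: bulleted_isB simp: valid_def nw_def)
  then show "slide ?H (i + 1, j + 1) z = mv ?H (i + 1, j + 1) (i,j) z"
    using assms(2) by (auto simp: slide_def Let_def up_def lft_def upl_def diag_def valid_def)
  show "isB ?H (up (i + 1, j + 1)) \<or> isB ?H (lft (i + 1, j + 1))"
    using B by (simp add: up_def)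
qed (use assms in \<open>auto simp: nw_def\<close>)

text \<open>Rule (R2) for a high letter: the entry \<open>x\<close> blocks the diagonal way.\<close>

lemma slides_blocked_high:
  assumes "front M A (i + 1, j + 1) z" "(i,j) \<in> valid" "i < j" "is_high z"
    and "M (i,j) = Some x" "x \<noteq> z" "(i, j + 1) \<notin> dom M" "(i + 1, j) \<notin> dom M"
  shows "slides (bulleted (M((i + 1, j + 1) \<mapsto> z))) = slides (bulleted (M((i + 1, j) \<mapsto> z)))"
proof (rule slides_mv[OF assms(1)])
  let ?H = "bulleted (M((i + 1, j + 1) \<mapsto> z))"
  have B: "isB ?H (i, j + 1)" "isB ?H (i + 1, j)"
    using assms by (auto intro!: bulleted_isB simp: valid_def nw_def)
  moreover have "\<not> isB ?H (i,j)" using assms by (auto simp: isB_bulleted)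
  ultimately show "slide ?H (i + 1, j + 1) z = mv ?H (i + 1, j + 1) (i + 1, j) z"
    using assms by (auto simp: slide_def Let_def up_def lft_def upl_def is_low_def entry_bulleted)
  show "isB ?H (up (i + 1, j + 1)) \<or> isB ?H (lft (i + 1, j + 1))"
    using B by (simp add: up_def)
qed (use assms in \<open>auto simp: nw_def valid_def\<close>)

text \<open>The equivalence joins two cases: off the diagonal a low letter goes up by (R2), and
  \<open>lower\<close> does nothing; on the diagonal a high letter goes up by (R5) and is lowered,
  its left neighbour being no cell.\<close>

lemma slides_blocked_low:
  assumes "front M A (i + 1, j + 1) z" "(i,j) \<in> valid" "is_low z \<longleftrightarrow> i < j"
    and "M (i,j) = Some x" "x \<noteq> z" "(i, j + 1) \<notin> dom M" "(i + 1, j) \<notin> dom M"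
  shows "slides (bulleted (M((i + 1, j + 1) \<mapsto> z))) = slides (bulleted (M((i, j + 1) \<mapsto> lower z)))"
proof (rule slides_mv[OF assms(1)])
  let ?H = "bulleted (M((i + 1, j + 1) \<mapsto> z))"
  have B: "isB ?H (i, j + 1)" "isB ?H (i + 1, j) \<longleftrightarrow> i < j"
    using assms by (auto intro!: bulleted_isB simp: valid_def nw_def)
      (auto simp: isB_bulleted valid_def)
  moreover have "\<not> isB ?H (i,j)" using assms by (auto simp: isB_bulleted)
  moreover have "is_low z \<Longrightarrow> lower z = z" by (cases z) (auto simp: is_low_def lower_def)
  ultimately show "slide ?H (i + 1, j + 1) z = mv ?H (i + 1, j + 1) (i, j + 1) (lower z)"
    using assms by (auto simp: slide_def Let_def up_def lft_def upl_def is_low_def diag_def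
        entry_bulleted isE_bulleted valid_def)
  show "isB ?H (up (i + 1, j + 1)) \<or> isB ?H (lft (i + 1, j + 1))"
    using B by (simp add: up_def)
qed (use assms in \<open>auto simp: nw_def valid_def\<close>)

lemma front_mono:
  assumes "front M A b z" "b' \<in> valid" "b' \<notin> dom M" "rank b' z' \<le> rank b z"
  shows "front M A b' z'"
  using assms unfolding front_def by (auto intro: order.strict_trans1)

text \<open>With no bullet above, the letter goes left by (R6), or by (R5), where raising a high
  letter changes nothing. Ties among high letters favour the west, so its rank only falls and it
  stays least.\<close>

lemma slides_left:
  assumes "j2 \<le> j" "front M A (r,j) (Hi k)" "(r,j2) \<in> valid"
    and "\<And>j'. j2 \<le> j' \<Longrightarrow> j' \<le> j \<Longrightarrow> (r,j') \<notin> dom M"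
    and "\<And>j'. j2 \<le> j' \<Longrightarrow> j' \<le> j \<Longrightarrow> r = 1 \<or> (r - 1, j') \<in> dom M"
  shows "slides (bulleted (M((r,j) \<mapsto> Hi k))) = slides (bulleted (M((r,j2) \<mapsto> Hi k)))"
  using assms
proof (induction j rule: dec_induct)
  case base
  then show ?case by simp
next
  case (step j)
  let ?H = "bulleted (M((r, Suc j) \<mapsto> Hi k))"
  have "front M A (r,j) (Hi k)"
    using step by (intro front_mono[OF step.prems(1)]) (auto simp: valid_def rank_def)
  then have IH: "slides (bulleted (M((r,j) \<mapsto> Hi k))) = slides (bulleted (M((r,j2) \<mapsto> Hi k)))"
    using step.prems by (intro step.IH) auto
  have l: "isB ?H (r,j)"
    using step by (intro bulleted_isB) (auto simp: valid_def nw_def)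
  \<comment> \<open>For \<open>r = 1\<close> this cell is in row 0, outside
    \<open>valid\<close>.\<close>
  have u: "\<not> isB ?H (r - 1, Suc j)"
    using step.prems(4)[of "Suc j"] step.hyps by (auto simp: isB_bulleted valid_def)
  have "slides ?H = slides (bulleted (M((r,j) \<mapsto> Hi k)))"
  proof (rule slides_mv[OF step.prems(1)])
    show "slide ?H (r, Suc j) (Hi k) = mv ?H (r, Suc j) (r,j) (Hi k)"
      using l u by (simp add: slide_def Let_def up_def lft_def is_low_def raise_def)
  qed (use l step in \<open>auto simp: lft_def valid_def nw_def\<close>)
  then show ?case using IH by (simp only:)
qed

text \<open>The counterpart for low letters: entries on the left leave only the way up by (R6), and
  ties among low letters favour the north. The bound \<open>i < c\<close> keeps the moving letter
  off the diagonal.\<close>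

lemma slides_up:
  assumes "i2 \<le> i" "front M A (i,c) (Lo k)" "(i2,c) \<in> valid" "i < c"
    and "\<And>i'. i2 \<le> i' \<Longrightarrow> i' \<le> i \<Longrightarrow> (i',c) \<notin> dom M"
    and "\<And>i'. i2 \<le> i' \<Longrightarrow> i' \<le> i \<Longrightarrow> (i', c - 1) \<in> dom M"
  shows "slides (bulleted (M((i,c) \<mapsto> Lo k))) = slides (bulleted (M((i2,c) \<mapsto> Lo k)))"
  using assms
proof (induction i rule: dec_induct)
  case base
  then show ?case by simp
next
  case (step i)
  let ?H = "bulleted (M((Suc i, c) \<mapsto> Lo k))"
  have "front M A (i,c) (Lo k)"
    using step by (intro front_mono[OF step.prems(1)]) (auto simp: valid_def rank_def)
  then have IH: "slides (bulleted (M((i,c) \<mapsto> Lo k))) = slides (bulleted (M((i2,c) \<mapsto> Lo k)))"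
    using step.prems by (intro step.IH) auto
  have u: "isB ?H (i,c)"
    using step by (intro bulleted_isB) (auto simp: valid_def nw_def)
  have l: "\<not> isB ?H (Suc i, c - 1)"
    using step.prems(5)[of "Suc i"] step.hyps by (auto simp: isB_bulleted)
  have "slides ?H = slides (bulleted (M((i,c) \<mapsto> Lo k)))"
  proof (rule slides_mv[OF step.prems(1)])
    show "slide ?H (Suc i, c) (Lo k) = mv ?H (Suc i, c) (i,c) (Lo k)"
      using l u step.prems(3) by (simp add: slide_def Let_def up_def lft_def diag_def)
  qed (use u step in \<open>auto simp: up_def valid_def nw_def\<close>)
  then show ?case using IH by (simp only:)
qed

subsection \<open>Adding the cells of a tableau one at a time\<close>

lemma ideal_insert_row:
  assumes "ideal D" "(r,j) \<in> valid" "(r,j) \<notin> D" "r = 1 \<or> (r - 1, j) \<in> D"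
  obtains j2 where "j2 \<le> j" "(r,j2) \<in> valid" "(r,j2) \<notin> D" "ideal (insert (r,j2) D)"
proof -
  \<comment> \<open>The first free cell of row \<open>r\<close>. It is at or before column
    \<open>j\<close>, so the cells above it are present.\<close>
  define j2 where "j2 = (LEAST j. r \<le> j \<and> (r,j) \<notin> D)"
  have *: "r \<le> j2 \<and> (r,j2) \<notin> D" unfolding j2_def
    by (rule LeastI[of _ j]) (use assms in \<open>auto simp: valid_def\<close>)
  have le: "j2 \<le> j" unfolding j2_def
    by (rule Least_le) (use assms in \<open>auto simp: valid_def\<close>)
  have before: "(r,b) \<in> D" if "r \<le> b" "b < j2" for b
    using that not_less_Least[of b "\<lambda>j. r \<le> j \<and> (r,j) \<notin> D"] unfolding j2_def by auto
  have v: "(r,j2) \<in> valid" using * assms(2) by (auto simp: valid_def)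
  have "(a,b) \<in> insert (r,j2) D" if "(a,b) \<in> valid" "nw (a,b) (r,j2)" for a b
  proof (cases "a = r")
    case True
    then show ?thesis using that before by (cases "b = j2") (auto simp: valid_def nw_def)
  next
    case False
    then have "nw (a,b) (r - 1, j)" "r \<noteq> 1" using that le by (auto simp: valid_def nw_def)
    then show ?thesis using idealD[OF assms(1) _ that(1)] assms(4) by auto
  qed
  then have "ideal (insert (r,j2) D)" using assms(1) v by (auto simp: ideal_def)
  then show ?thesis using that le v * by blast
qed

lemma ideal_insert_col:
  assumes "ideal D" "(i,c) \<in> valid" "(i,c) \<notin> D" "(i, c - 1) \<in> D"
  obtains i2 where "i2 \<le> i" "(i2,c) \<in> valid" "(i2,c) \<notin> D" "ideal (insert (i2,c) D)"
proof -
  \<comment> \<open>The topmost free cell of column \<open>c\<close>. It is at or above row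
    \<open>i\<close>, so the cells to its left are present.\<close>
  define i2 where "i2 = (LEAST i. 1 \<le> i \<and> (i,c) \<notin> D)"
  have *: "1 \<le> i2 \<and> (i2,c) \<notin> D" unfolding i2_def
    by (rule LeastI[of _ i]) (use assms in \<open>auto simp: valid_def\<close>)
  have le: "i2 \<le> i" unfolding i2_def
    by (rule Least_le) (use assms in \<open>auto simp: valid_def\<close>)
  have before: "(a,c) \<in> D" if "1 \<le> a" "a < i2" for a
    using that not_less_Least[of a "\<lambda>i. 1 \<le> i \<and> (i,c) \<notin> D"] unfolding i2_def by auto
  have v: "(i2,c) \<in> valid" using * le assms(2) by (auto simp: valid_def)
  have "(a,b) \<in> insert (i2,c) D" if "(a,b) \<in> valid" "nw (a,b) (i2,c)" for a b
  proof (cases "b = c")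
    case True
    then show ?thesis using that before by (cases "a = i2") (auto simp: valid_def nw_def)
  next
    case False
    then have "nw (a,b) (i, c - 1)" using that le by (auto simp: valid_def nw_def)
    then show ?thesis using idealD[OF assms(1,4) that(1)] by auto
  qed
  then have "ideal (insert (i2,c) D)" using assms(1) v by (auto simp: ideal_def)
  then show ?thesis using that le v * by blast
qed

text \<open>Row \<open>a + 1\<close> of the shifted diagram ends in column
  \<open>lam ! a + a\<close>; strictness makes these ends weakly decrease.\<close>

lemma strict_part_gap:
  assumes "strict_part lam" "a \<le> b" "b < length lam"
  shows "lam ! b + b \<le> lam ! a + a"
  using assms(2,3)
proof (induction b rule: dec_induct)
  case base
  then show ?case by simp
next
  case (step b)
  then have "lam ! Suc b < lam ! b"
    using assms(1) by (auto simp: strict_part_def sorted_wrt_iff_nth_less)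
  then show ?case using step by simp
qed

lemma ideal_shdiag:
  assumes "strict_part lam"
  shows "ideal (shdiag lam)"
proof -
  have "(i',j') \<in> shdiag lam" if "(i,j) \<in> shdiag lam" "(i',j') \<in> valid" "nw (i',j') (i,j)" for i j i' j'
  proof -
    have *: "1 \<le> i'" "i' \<le> i" "i' \<le> j'" "j' \<le> j" "i \<le> length lam" "j < i + lam ! (i - 1)"
      using that by (auto simp: shdiag_def valid_def nw_def)
    then have "lam ! (i - 1) + (i - 1) \<le> lam ! (i' - 1) + (i' - 1)"
      by (intro strict_part_gap[OF assms]) auto
    then have "j' < i' + lam ! (i' - 1)" using * by linarith
    then show ?thesis using * by (auto simp: shdiag_def)
  qed
  moreover have "shdiag lam \<subseteq> valid" by (auto simp: shdiag_def valid_def)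
  ultimately show ?thesis unfolding ideal_def by (metis surj_pair)
qed

lemma finite_shdiag: "finite (shdiag lam)"
proof -
  have "shdiag lam \<subseteq> (\<Union>i\<in>{1..length lam}. {i} \<times> {i..<i + lam ! (i - 1)})"
    by (auto simp: shdiag_def)
  then show ?thesis by (rule finite_subset) auto
qed

lemma semistandardD:
  assumes "semistandard nu mu T"
  shows "strict_part nu"
    and "dom T = shdiag nu - shdiag mu"
    and "\<forall>i j j' a b. T (i,j) = Some a \<longrightarrow> T (i,j') = Some b \<longrightarrow> j < j' \<longrightarrow> key a \<le> key b"
    and "\<forall>i i' j a b. T (i,j) = Some a \<longrightarrow> T (i',j) = Some b \<longrightarrow> i < i' \<longrightarrow> key a \<le> key b"
    and "\<forall>i a. T (i,i) = Some a \<longrightarrow> is_high a"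
    and "\<forall>i i' j k. T (i,j) = Some (Hi k) \<longrightarrow> T (i',j) = Some (Hi k) \<longrightarrow> i = i'"
    and "\<forall>i j j' k. T (i,j) = Some (Lo k) \<longrightarrow> T (i,j') = Some (Lo k) \<longrightarrow> j = j'"
  using assms unfolding semistandard_def by - (elim conjE, assumption)+

section \<open>The given tableau and the order of its cells\<close>

locale insertion =
  fixes lam :: "nat list" and T :: tab and y :: nat
  assumes ss: "semistandard lam [] T"
    and ss_oplus: "semistandard (oplus_outer lam) (oplus_inner lam) (oplus lam T y)"
begin

abbreviation f :: nat where "f \<equiv> first_part lam"

text \<open>Ranks at the positions in \<open>T\<close>. Shifting both cells diagonally by one
  preserves comparisons (\<open>rank_shift\<close>), so this is the order in which rectification
  treats the cells.\<close>

definition rk :: "nat \<times> nat \<Rightarrow> nat \<times> nat \<times> nat" where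
  "rk c = rank c (the (T c))"

lemma strict_lam: "strict_part lam"
  by (rule semistandardD(1)[OF ss])

lemma dom_T: "dom T = shdiag lam"
  using semistandardD(2)[OF ss] by (auto simp: shdiag_def)

lemma ideal_T: "ideal (dom T)" and finite_T: "finite (dom T)"
  using ideal_shdiag[OF strict_lam] finite_shdiag by (simp_all add: dom_T)

lemmas diag_high = semistandardD(5)[OF ss, rule_format]
  and col_high = semistandardD(6)[OF ss, rule_format]
  and row_low = semistandardD(7)[OF ss, rule_format]

lemma row_le: "T (i,j) = Some a \<Longrightarrow> T (i,j') = Some b \<Longrightarrow> j \<le> j' \<Longrightarrow> key a \<le> key b"
  using semistandardD(3)[OF ss, rule_format, of i j a j' b] by (cases "j = j'") auto

lemma col_le: "T (i,j) = Some a \<Longrightarrow> T (i',j) = Some b \<Longrightarrow> i \<le> i' \<Longrightarrow> key a \<le> key b"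
  using semistandardD(4)[OF ss, rule_format, of i j a i' b] by (cases "i = i'") auto

lemma col_le_first: "(i,j) \<in> dom T \<Longrightarrow> j \<le> f"
proof -
  assume a: "(i,j) \<in> dom T"
  then have l: "1 \<le> i" "i \<le> length lam" "j < i + lam ! (i - 1)" unfolding dom_T by (auto simp: shdiag_def)
  moreover have "lam ! (i - 1) + (i - 1) \<le> lam ! 0"
    using strict_part_gap[OF strict_lam, of 0 "i - 1"] l by simp
  moreover have "lam ! 0 = f" using l by (cases lam) (auto simp: first_part_def)
  ultimately show ?thesis by linarith
qed

text \<open>In \<open>oplus lam T y\<close> the last column of \<open>T\<close> is shifted below
  \<open>Hi y\<close>, whose key is \<open>2 * y + 1\<close>. Weak increase down this column, with a
  single copy of each high letter, gives a strict inequality.\<close>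

lemma last_col:
  assumes "T (i,f) = Some a"
  shows "2 * y + 1 < key a"
proof -
  have "(i,f) \<in> valid" using assms ideal_T by (auto simp: ideal_def)
  then have v: "1 \<le> i" "1 \<le> f" by (auto simp: valid_def)
  have 1: "oplus lam T y (1, f + 1) = Some (Hi y)" by (simp add: oplus_def)
  have 2: "oplus lam T y (i + 1, f + 1) = Some a" using v assms by (simp add: oplus_def)
  have "key (Hi y) \<le> key a"
    using semistandardD(4)[OF ss_oplus, rule_format, OF 1 2] v by simp
  moreover have "a \<noteq> Hi y"
  proof
    assume "a = Hi y"
    with semistandardD(6)[OF ss_oplus, rule_format, OF 1] 2 have "1 = i + 1" by blast
    with v show False by simp
  qed
  ultimately show ?thesis using key_inject[of "Hi y" a] by fastforce
qed

lemma rk_inject: "rk c = rk c' \<Longrightarrow> c = c'"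
  unfolding rk_def by (metis cell_of_rank)

lemma key_le_rk: "rk c \<le> rk c' \<Longrightarrow> key (the (T c)) \<le> key (the (T c'))"
  by (auto simp: rk_def rank_def less_eq_prod_def split: if_splits)

text \<open>So \<open>rk\<close> linearly extends \<open>nw\<close>, and its initial segments are
  order ideals. If the keys agree, the corner \<open>(i,j')\<close> holds the same letter; a low
  letter forces \<open>j = j'\<close>, a high one \<open>i = i'\<close>, and the tie rule decides by
  the other coordinate.\<close>

lemma rk_nw:
  assumes "c \<in> dom T" "c' \<in> dom T" "nw c c'" "c \<noteq> c'"
  shows "rk c < rk c'"
proof -
  obtain i j i' j' where c: "c = (i,j)" "c' = (i',j')" by (cases c, cases c') auto
  have v: "(i,j) \<in> valid" "(i',j') \<in> valid" using assms ideal_T c by (auto simp: ideal_def)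
  then have "(i,j') \<in> dom T"
    using idealD[OF ideal_T assms(2), of "(i,j')"] assms(3) c by (auto simp: valid_def nw_def)
  then obtain a b d where t: "T (i,j) = Some a" "T (i,j') = Some b" "T (i',j') = Some d"
    using assms c by auto
  have ij: "i \<le> i'" "j \<le> j'" using assms(3) c by (auto simp: nw_def)
  have ab: "key a \<le> key b" "key b \<le> key d" 
    using row_le[OF t(1,2) ij(2)] col_le[OF t(2,3) ij(1)] by auto
  show ?thesis
  proof (cases "key a = key d")
    case True
    then have "key b = key a" "key d = key a" using ab by auto
    then have eq: "b = a" "d = a" using key_inject by blast+
    show ?thesis
    proof (cases a)
      case (Lo k)
      then have "j = j'" using t(1,2) eq row_low by simp
      then show ?thesis using assms(4) t ij eq Lo c by (auto simp: rk_def rank_def)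
    next
      case (Hi k)
      then have "i = i'" using t(2,3) eq col_high by simp
      then show ?thesis using assms(4) t ij eq Hi c by (auto simp: rk_def rank_def)
    qed
  next
    case False
    then show ?thesis using ab t c by (auto simp: rk_def rank_def)
  qed
qed

section \<open>Initial segments of the order of treatment\<close>

definition closed :: "(nat \<times> nat) set \<Rightarrow> bool" where
  "closed D \<longleftrightarrow> D \<subseteq> dom T \<and> (\<forall>c\<in>D. \<forall>c'\<in>dom T. rk c' < rk c \<longrightarrow> c' \<in> D)"

definition follows :: "(nat \<times> nat) set \<Rightarrow> nat \<times> nat \<Rightarrow> bool" where
  "follows D e \<longleftrightarrow> closed D \<and> e \<in> dom T - D \<and> (\<forall>c\<in>dom T - insert e D. rk e < rk c)"

lemma closed_ideal: "closed D \<Longrightarrow> ideal D"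
  unfolding ideal_def
proof (intro conjI ballI impI)
  assume D: "closed D"
  then show "D \<subseteq> valid" using ideal_T by (auto simp: closed_def ideal_def)
  fix c c' assume c: "c \<in> D" "c' \<in> valid" "nw c' c"
  then have "c' \<in> dom T" using D idealD[OF ideal_T, of c c'] by (auto simp: closed_def)
  then show "c' \<in> D" using D c rk_nw[of c' c] unfolding closed_def by blast
qed

lemma rk_linear: "c \<noteq> c' \<Longrightarrow> \<not> rk c < rk c' \<Longrightarrow> rk c' < rk c"
  using rk_inject[of c c'] by (meson linorder_neqE)

lemma follows_less:
  assumes "follows D e" "c \<in> D"
  shows "rk c < rk e"
proof (rule ccontr)
  assume "\<not> rk c < rk e"
  moreover have "c \<noteq> e" using assms by (auto simp: follows_def)
  ultimately have "rk e < rk c" by (intro rk_linear)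
  then show False using assms unfolding follows_def closed_def by blast
qed

lemma follows_closed:
  assumes "follows D e"
  shows "closed (insert e D)"
  unfolding closed_def
proof (intro conjI ballI impI)
  show "insert e D \<subseteq> dom T" using assms by (auto simp: follows_def closed_def)
  fix c c' assume c: "c \<in> insert e D" "c' \<in> dom T" "rk c' < rk c"
  show "c' \<in> insert e D"
  proof (cases "c = e")
    case True
    then have "\<not> rk e < rk c'" using c(3) by (meson order.asym)
    then show ?thesis using assms c(2) unfolding follows_def by blast
  next
    case False
    then show ?thesis using assms c unfolding follows_def closed_def by blast
  qed
qed

lemma closed_finite: "closed D \<Longrightarrow> finite D"
  using finite_T finite_subset by (auto simp: closed_def)

text \<open>Cells are added to \<open>D0\<close> in increasing rank; the proof goes backwards and
  removes the cell of maximal rank.\<close>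

lemma closed_induct [consumes 3, case_names base step]:
  assumes "closed D" "closed D0" "D0 \<subseteq> D" "P D0"
    and "\<And>D e. D0 \<subseteq> D \<Longrightarrow> follows D e \<Longrightarrow> P D \<Longrightarrow> P (insert e D)"
  shows "P D"
  using assms(1,3)
proof (induction "card (D - D0)" arbitrary: D)
  case 0
  then have "D = D0" using closed_finite by auto
  then show ?case using assms(4) by simp
next
  case (Suc n)
  have fin: "finite (D - D0)" and ne: "D - D0 \<noteq> {}" using Suc closed_finite by auto
  define m where "m = Max (rk ` (D - D0))"
  have "m \<in> rk ` (D - D0)" unfolding m_def using fin ne by (intro Max_in) auto
  then obtain e where e: "e \<in> D - D0" "rk e = m" by auto
  have max: "rk c \<le> rk e" if "c \<in> D - D0" for c
    unfolding e(2) m_def using fin that by auto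
  have cl: "closed (D - {e})"
    unfolding closed_def
  proof (intro conjI ballI impI)
    show "D - {e} \<subseteq> dom T" using Suc.prems by (auto simp: closed_def)
    fix c c' assume c: "c \<in> D - {e}" "c' \<in> dom T" "rk c' < rk c"
    have "c' \<noteq> e"
    proof
      assume "c' = e"
      \<comment> \<open>By maximality of \<open>e\<close> a cell \<open>c\<close> of larger rank
        must be in \<open>D0\<close>, and then so is \<open>e\<close>, as \<open>D0\<close> is an
        initial segment.\<close>
      with c max[of c] have "c \<in> D0" by (auto dest: leD)
      with c assms(2) \<open>c' = e\<close> e show False unfolding closed_def by blast
    qed
    with c Suc.prems(1) show "c' \<in> D - {e}" unfolding closed_def by blast
  qed
  have "follows (D - {e}) e"
    unfolding follows_def
  proof (intro conjI ballI)
    show "closed (D - {e})" by (rule cl)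
    show "e \<in> dom T - (D - {e})" using e Suc.prems by (auto simp: closed_def)
    fix c assume c: "c \<in> dom T - insert e (D - {e})"
    with e Suc.prems(1) have "\<not> rk c < rk e" "c \<noteq> e" unfolding closed_def by blast+
    then show "rk e < rk c" by (intro rk_linear)
  qed
  moreover have "P (D - {e})"
  proof (rule Suc.hyps(1))
    show "n = card (D - {e} - D0)"
    proof -
      have "D - {e} - D0 = (D - D0) - {e}" by blast
      then show ?thesis using Suc.hyps(2) e(1) fin by simp
    qed
  qed (use cl e Suc.prems in auto)
  moreover have "D0 \<subseteq> D - {e}" using e(1) Suc.prems(2) by blast
  ultimately have "P (insert e (D - {e}))" by (intro assms(5))
  then show ?case using e by (simp add: insert_absorb)
qed

section \<open>Entries still in shifted position\<close>

definition shifted :: "(nat \<times> nat) set \<Rightarrow> tab" where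
  "shifted D = (\<lambda>(i,j). if 2 \<le> i \<and> 2 \<le> j then (T |` (- D)) (i - 1, j - 1) else None)"

lemma shiftedE:
  assumes "shifted D c = Some x"
  obtains i j where "c = (i + 1, j + 1)" "(i,j) \<in> dom T" "(i,j) \<notin> D" "T (i,j) = Some x"
proof -
  obtain a b where c: "c = (a,b)" by (cases c)
  with assms have "2 \<le> a" "2 \<le> b" "T (a - 1, b - 1) = Some x" "(a - 1, b - 1) \<notin> D"
    by (auto simp: shifted_def restrict_map_def split: if_splits)
  then show ?thesis using that[of "a - 1" "b - 1"] c by auto
qed

lemma shifted_split:
  assumes "(i,j) \<in> dom T - D"
  shows "shifted D = (shifted (insert (i,j) D))((i + 1, j + 1) \<mapsto> the (T (i,j)))"
proof
  fix c :: "nat \<times> nat"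
  obtain a b where c: "c = (a,b)" by (cases c)
  have "(i,j) \<in> valid" using assms ideal_T by (auto simp: ideal_def)
  then have "1 \<le> i" "1 \<le> j" by (auto simp: valid_def)
  then show "shifted D c = ((shifted (insert (i,j) D))((i + 1, j + 1) \<mapsto> the (T (i,j)))) c"
    using assms c by (auto simp: shifted_def restrict_map_def)
qed

text \<open>The original cell of such an entry would lie in the ideal \<open>D\<close>. Truncated
  subtraction is harmless, since row 1 and column 1 of \<open>shifted D\<close> are empty.\<close>

lemma shifted_none:
  assumes "ideal D" "e \<in> D" "nw (a - 1, b - 1) e"
  shows "(a,b) \<notin> dom (shifted D)"
proof
  assume "(a,b) \<in> dom (shifted D)"
  then obtain x where "shifted D (a,b) = Some x" by auto
  then obtain i j where "(a,b) = (i + 1, j + 1)" "(i,j) \<in> dom T" "(i,j) \<notin> D" by (rule shiftedE)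
  then show False
    using assms(3) idealD[OF assms(1,2), of "(i,j)"] ideal_T by (auto simp: ideal_def)
qed

lemma finite_shifted: "finite (dom (shifted D))"
proof -
  have "dom (shifted D) \<subseteq> (\<lambda>(i,j). (i + 1, j + 1)) ` dom T"
    by (force elim!: shiftedE)
  then show ?thesis using finite_T by (meson finite_imageI finite_subset)
qed

lemma shifted_valid: "dom (shifted D) \<subseteq> valid"
proof
  fix c assume "c \<in> dom (shifted D)"
  then obtain x where "shifted D c = Some x" by auto
  then obtain i j where "c = (i + 1, j + 1)" "(i,j) \<in> dom T" by (rule shiftedE)
  then show "c \<in> valid" using ideal_T by (auto simp: ideal_def valid_def)
qed

lemma rank_shift: "rank (i,j) x < rank (i',j') x' \<longleftrightarrow> rank (i + 1, j + 1) x < rank (i' + 1, j' + 1) x'"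
  by (simp add: rank_def)

text \<open>Shifted entries come later by \<open>follows\<close>, so \<open>rest\<close> only
  concerns entries of \<open>I\<close> outside \<open>A\<close>. In the uses below this is just
  \<open>Hi y\<close> waiting in row 1, or nothing because \<open>A\<close> is all of
  \<open>dom I\<close>.\<close>

lemma front_state:
  assumes e: "follows D (i,j)" and A: "ideal A" "A \<subseteq> dom I" and I: "finite (dom I)" "dom I \<subseteq> valid"
    and "(i + 1, j + 1) \<notin> dom I"
    and rest: "\<And>c x. I c = Some x \<Longrightarrow> c \<notin> A \<Longrightarrow> rank (i + 1, j + 1) (the (T (i,j))) < rank c x"
  shows "front (I ++ shifted (insert (i,j) D)) A (i + 1, j + 1) (the (T (i,j)))"
  unfolding front_def
proof (intro conjI allI impI)
  let ?S = "shifted (insert (i,j) D)"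
  have id: "ideal (insert (i,j) D)" using e follows_closed closed_ideal by blast
  show "finite (dom (I ++ ?S))" using I finite_shifted by simp
  show "dom (I ++ ?S) \<subseteq> valid" using I shifted_valid by auto
  show "A \<subseteq> dom (I ++ ?S)" using A by auto
  show "(i + 1, j + 1) \<in> valid" using id by (auto simp: ideal_def valid_def)
  show "(i + 1, j + 1) \<notin> dom (I ++ ?S)"
    using assms(6) shifted_none[OF id, of "(i,j)" "i + 1" "j + 1"] by (auto simp: nw_def)
  fix c x assume "(I ++ ?S) c = Some x" "c \<notin> A"
  then consider "I c = Some x" "c \<notin> A" | "?S c = Some x" by (auto simp: map_add_Some_iff)
  then show "rank (i + 1, j + 1) (the (T (i,j))) < rank c x"
  proof cases
    case 1
    then show ?thesis by (rule rest)
  next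
    case 2
    then obtain i' j' where c: "c = (i' + 1, j' + 1)" "(i',j') \<in> dom T" "(i',j') \<notin> insert (i,j) D"
      "T (i',j') = Some x" by (rule shiftedE)
    then have "rk (i,j) < rk (i',j')" using e by (auto simp: follows_def)
    then show ?thesis using c rank_shift by (simp add: rk_def)
  qed
qed (rule A)

section \<open>The induction over the treated cells\<close>

definition small :: "(nat \<times> nat) set" where
  "small = {c \<in> dom T. key (the (T c)) \<le> 2 * y + 1}"

lemma closed_small: "closed small"
  unfolding closed_def small_def using key_le_rk by (fastforce dest: less_imp_le)

lemma closed_empty: "closed {}"
  by (simp add: closed_def)

text \<open>While letters up to \<open>Hi y\<close> are treated, \<open>Hi y\<close> waits at the
  end of row 1 and each treated entry returns to its cell in \<open>T\<close> by (R1).\<close>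

lemma slides_small:
  assumes "closed D" "D \<subseteq> small"
  shows "slides (bulleted (oplus lam T y)) =
    slides (bulleted ((T |` D)((1, f + 1) \<mapsto> Hi y) ++ shifted D))"
  using assms(1) closed_empty empty_subsetI assms(2)
proof (induction D rule: closed_induct)
  case base
  have "oplus lam T y = (T |` {})((1, f + 1) \<mapsto> Hi y) ++ shifted {}"
    by (auto simp: oplus_def shifted_def map_add_def fun_eq_iff restrict_map_def
        split: option.splits if_splits)
  then show ?case by (simp only:)
next
  case (step D e)
  obtain i j where e: "e = (i,j)" by (cases e)
  let ?I = "(T |` D)((1, f + 1) \<mapsto> Hi y)" and ?S = "shifted (insert e D)"
  note nx = step.hyps(2)
  have D: "ideal D" "closed D" and D': "ideal (insert e D)"
    using nx follows_closed closed_ideal by (auto simp: follows_def)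
  have domD: "dom (T |` D) = D" using D by (auto simp: closed_def)
  have eT: "e \<in> dom T" "e \<notin> D" using nx by (auto simp: follows_def)
  have v: "(i,j) \<in> valid" using D' e by (auto simp: ideal_def)
  have key: "key (the (T (i,j))) \<le> 2 * y + 1" using step.prems e by (auto simp: small_def)
  \<comment> \<open>By \<open>last_col\<close> no such letter is in the last column, so
    \<open>(1, f + 1)\<close> is not among the cells needed for the diagonal slide.\<close>
  have j: "j < f" using col_le_first[of i j] last_col[of i] eT e key by (cases "j = f") auto
  have out: "c \<notin> D" if "nw e c" for c
    using idealD[OF D(1) _ _ that] eT D' by (auto simp: ideal_def)
  \<comment> \<open>A copy of \<open>Hi y\<close> in \<open>T\<close> lies west of column
    \<open>f\<close> and so wins the tie.\<close>
  have rank_y: "rank (i + 1, j + 1) (the (T (i,j))) < rank (1, f + 1) (Hi y)"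
    using key j by (cases "the (T (i,j))") (auto simp: rank_def, presburger)
  have fr: "front (?I ++ ?S) D (i + 1, j + 1) (the (T (i,j)))"
    unfolding e
  proof (rule front_state)
    show "follows D (i,j)" using nx e by simp
    show "finite (dom ((T |` D)((1, f + 1) \<mapsto> Hi y)))" using closed_finite D domD by simp
    show "dom ((T |` D)((1, f + 1) \<mapsto> Hi y)) \<subseteq> valid"
      using D domD by (auto simp: ideal_def valid_def)
    show "(i + 1, j + 1) \<notin> dom ((T |` D)((1, f + 1) \<mapsto> Hi y))"
      using out[of "(i + 1, j + 1)"] e domD j by (auto simp: nw_def)
    fix c x assume "((T |` D)((1, f + 1) \<mapsto> Hi y)) c = Some x" "c \<notin> D"
    then have "c = (1, f + 1)" "x = Hi y" by (auto simp: restrict_map_def split: if_splits)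
    then show "rank (i + 1, j + 1) (the (T (i,j))) < rank c x" using rank_y by simp
  qed (use D domD in auto)
  have "slides (bulleted (oplus lam T y)) = slides (bulleted (?I ++ shifted D))"
    using step by blast
  also have "?I ++ shifted D = (?I ++ ?S)((i + 1, j + 1) \<mapsto> the (T (i,j)))"
    using shifted_split[of i j D] eT e by (simp add: map_add_upd)
  also have "slides (bulleted \<dots>) = slides (bulleted ((?I ++ ?S)((i,j) \<mapsto> the (T (i,j)))))"
  proof (rule slides_diagonal[OF fr v])
    have S: "(i,j) \<notin> dom ?S" "(i, j + 1) \<notin> dom ?S" "(i + 1, j) \<notin> dom ?S"
      using shifted_none[OF D', of e] e by (auto simp: nw_def)
    show "(i,j) \<notin> dom (?I ++ ?S)" "(i, j + 1) \<notin> dom (?I ++ ?S)" "(i + 1, j) \<notin> dom (?I ++ ?S)"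
      using S out[of "(i,j)"] out[of "(i, j + 1)"] out[of "(i + 1, j)"] e domD j v
      by (auto simp: nw_def valid_def)
  qed
  also have "(?I ++ ?S)((i,j) \<mapsto> the (T (i,j))) = ?I((i,j) \<mapsto> the (T (i,j))) ++ ?S"
    using shifted_none[OF D', of e i j] e by (subst map_add_upd_left) (auto simp: nw_def)
  also have "?I((i,j) \<mapsto> the (T (i,j))) = (T |` (insert e D))((1, f + 1) \<mapsto> Hi y)"
    using e eT j by (auto simp: fun_eq_iff restrict_map_def)
  finally show ?case .
qed

text \<open>The strict inequality at \<open>p\<close> makes both procedures react once
  \<open>p\<close> is reached: insertion bumps only strictly greater letters, and (R2) needs an
  entry different from the moving one.\<close>

definition stage :: "(nat \<times> nat) set \<Rightarrow> tab \<Rightarrow> nat \<times> nat \<Rightarrow> bool" where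
  "stage D I p \<longleftrightarrow> runs (T |` D) (RowIns 1 (Hi y)) I p \<and> p \<notin> D \<and> ideal (insert p D) \<and>
     dom I = insert p D \<and> (p \<in> dom T \<longrightarrow> key (the (I p)) < key (the (T p))) \<and>
     slides (bulleted (oplus lam T y)) = slides (bulleted (I ++ shifted D))"

text \<open>No letter of \<open>small\<close> exceeds \<open>Hi y\<close>, so insertion appends it
  to row 1. Rectification slides it left to the same cell, because all remaining letters are
  greater.\<close>

lemma stage_small: "\<exists>I p. stage small I p"
proof -
  have id: "ideal small" using closed_small closed_ideal by blast
  have sub: "small \<subseteq> dom T" by (auto simp: small_def)
  have f: "(1, f + 1) \<notin> dom T" using col_le_first[of 1 "f + 1"] by auto
  obtain j2 where j2: "j2 \<le> f + 1" "(1,j2) \<in> valid" "(1,j2) \<notin> small" "ideal (insert (1,j2) small)"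
    by (rule ideal_insert_row[OF id, of 1 "f + 1"]) (use f sub in \<open>auto simp: valid_def\<close>)
  have dom: "dom (T |` small) = small" using sub by auto
  let ?I = "(T |` small)((1,j2) \<mapsto> Hi y)" and ?M = "(T |` small) ++ shifted small"
  have le: "line_end small (RowIns 1 (Hi y)) = (1,j2)"
    by (rule line_end_eqI[OF id j2(4,3)]) simp
  have "fits (T |` small) (RowIns 1 (Hi y))"
    by (auto simp: fits_def small_def restrict_map_def split: if_splits)
  then have "runs (T |` small) (RowIns 1 (Hi y)) ?I (1,j2)"
    using runs.place[of "T |` small" "RowIns 1 (Hi y)" "(1,j2)"] dom le by (simp del: line_end.simps)
  moreover have "2 * y + 1 < key (the (T (1,j2)))" if "(1,j2) \<in> dom T"
    using j2(3) that by (auto simp: small_def)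
  moreover have "slides (bulleted (oplus lam T y)) = slides (bulleted (?I ++ shifted small))"
  proof -
    have row1: "(1,j) \<notin> dom (shifted small)" for j by (auto simp: shifted_def)
    have out: "(1,j) \<notin> small" if "j2 \<le> j" for j
      using idealD[OF id _ j2(2), of "(1,j)"] j2(3) that by (auto simp: nw_def)
    have upd: "(T |` small)((1,j) \<mapsto> Hi y) ++ shifted small = ?M((1,j) \<mapsto> Hi y)" for j
      using row1 by (simp add: map_add_upd_left)
    have "front ?M small (1, f + 1) (Hi y)"
      unfolding front_def
    proof (intro conjI allI impI)
      show "finite (dom ?M)" using closed_finite[OF closed_small] finite_shifted dom by simp
      show "dom ?M \<subseteq> valid" using shifted_valid id dom by (auto simp: ideal_def)
      show "small \<subseteq> dom ?M" using dom by auto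
      show "(1, f + 1) \<in> valid" by (simp add: valid_def)
      show "(1, f + 1) \<notin> dom ?M" using row1 f by auto
      fix c x assume "?M c = Some x" "c \<notin> small"
      then have "shifted small c = Some x" by (auto simp: map_add_Some_iff restrict_map_def split: if_splits)
      then obtain i j where "c = (i + 1, j + 1)" "(i,j) \<in> dom T" "(i,j) \<notin> small" "T (i,j) = Some x"
        by (rule shiftedE)
      then have "2 * y + 1 < key x" by (auto simp: small_def)
      then show "rank (1, f + 1) (Hi y) < rank c x" by (simp add: rank_def)
    qed (rule id)
    then have "slides (bulleted (?M((1, f + 1) \<mapsto> Hi y))) = slides (bulleted (?M((1,j2) \<mapsto> Hi y)))"
      using j2 row1 out dom by (intro slides_left) auto
    then show ?thesis using slides_small[OF closed_small] upd by simp
  qed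
  ultimately have "stage small ?I (1,j2)" using j2 dom by (auto simp: stage_def)
  then show ?thesis by blast
qed

text \<open>So a letter lowered on leaving the diagonal still dominates all entries treated before.\<close>

lemma follows_diag_key:
  assumes "follows D (i,i)" "c \<in> D"
  shows "key (the (T c)) < key (the (T (i,i)))"
proof -
  obtain a b where c: "c = (a,b)" by (cases c)
  obtain k where k: "T (i,i) = Some (Hi k)"
    using assms(1) diag_high[of i] by (auto simp: follows_def) (metis is_high.elims(2))
  have cT: "c \<in> dom T" using assms by (auto simp: follows_def closed_def)
  have lt: "rk c < rk (i,i)" using follows_less assms by blast
  then have le: "key (the (T c)) \<le> key (the (T (i,i)))" by (intro key_le_rk) auto
  show ?thesis
  proof (rule ccontr)
    assume "\<not> ?thesis"
    then have "the (T c) = Hi k" using le k key_inject by (metis le_neq_implies_less option.sel)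
    then have cHi: "T (a,b) = Some (Hi k)" using cT c by auto
    \<comment> \<open>Equal high letters are treated from west to east. The corner
      \<open>(a,i)\<close> is squeezed between two copies of \<open>Hi k\<close>, giving a second
      copy in column \<open>i\<close> unless \<open>a = i\<close>, which \<open>ord\<close> and
      \<open>a \<le> b\<close> exclude.\<close>
    then have ord: "b < i \<or> b = i \<and> a < i" using lt k c by (auto simp: rk_def rank_def)
    have "(a,b) \<in> valid" using cT c ideal_T by (auto simp: ideal_def)
    then have ab: "1 \<le> a" "a \<le> b" by (auto simp: valid_def)
    moreover have "(i,i) \<in> dom T" using k by auto
    ultimately have "(a,i) \<in> dom T"
      using idealD[OF ideal_T, of "(i,i)" "(a,i)"] ord by (auto simp: valid_def nw_def)
    then obtain x where x: "T (a,i) = Some x" by auto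
    have "key (Hi k) \<le> key x" using row_le[OF cHi x] ord by auto
    moreover have "key x \<le> key (Hi k)" using col_le[OF x k] ab ord by auto
    ultimately have "x = Hi k" using key_inject by (metis le_antisym)
    then have "a = i" using col_high x k by blast
    then show False using ord ab by auto
  qed
qed

lemma stage_step:
  assumes "stage D I p" "follows D e" "small \<subseteq> D"
  shows "\<exists>I p. stage (insert e D) I p"
proof -
  obtain i j where e: "e = (i,j)" by (cases e)
  let ?D = "insert e D"
  let ?S = "shifted ?D"
  define z where "z = the (T e)"
  have D: "ideal D" "closed D" and D': "ideal ?D"
    using assms(2) follows_closed closed_ideal by (auto simp: follows_def)
  have eT: "T e = Some z" "e \<in> dom T" "e \<notin> D" using assms(2) by (auto simp: follows_def z_def)
  have v: "(i,j) \<in> valid" using D' e by (auto simp: ideal_def)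
  have domD: "dom (T |` D) = D" using D by (auto simp: closed_def)
  have runs: "runs (T |` D) (RowIns 1 (Hi y)) I p" and pD: "p \<notin> D" "ideal (insert p D)"
    and domI: "dom I = insert p D"
    and pT: "p \<in> dom T \<Longrightarrow> key (the (I p)) < key (the (T p))"
    and sl: "slides (bulleted (oplus lam T y)) = slides (bulleted (I ++ shifted D))"
    using assms(1) by (auto simp: stage_def)
  have yz: "2 * y + 1 < key z" using eT assms(3) by (auto simp: small_def)
  have Dz: "key x \<le> key z" if "(T |` D) c = Some x" for c x
    using that follows_less[OF assms(2), of c] key_le_rk[of c e] eT
    by (auto simp: restrict_map_def split: if_splits)
  have out: "c \<notin> D" if "nw e c" for c
    using idealD[OF D(1) _ _ that] eT D' by (auto simp: ideal_def)
  have outI: "c \<notin> dom I" if "nw e c" "c \<noteq> e" "c \<noteq> p \<or> e = p" for c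
    using that out domI by auto
  have S: "(a,b) \<notin> dom ?S" if "nw (a - 1, b - 1) e" for a b
    using shifted_none[OF D' _ that] by auto
  have upd: "(T |` D)(e \<mapsto> z) = T |` ?D" using eT by (auto simp: fun_eq_iff restrict_map_def)
  have ru: "if p \<noteq> e then runs (T |` ?D) (RowIns 1 (Hi y)) (I(e \<mapsto> z)) p
    else key (the (I e)) < key z \<longrightarrow>
      (\<forall>I' q. runs I (bump_act e z) I' q \<longrightarrow> runs (T |` ?D) (RowIns 1 (Hi y)) I' q)"
    unfolding upd[symmetric] using runs_upd[OF runs, of e z] D D' domD eT Dz yz by auto
  have front: "front (I ++ ?S) (insert p D) (i + 1, j + 1) z"
  proof -
    have "(i + 1, j + 1) \<notin> dom I"
    proof
      assume "(i + 1, j + 1) \<in> dom I"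
      moreover from this have "e \<in> insert p D"
        using idealD[OF pD(2), of "(i + 1, j + 1)" e] v domI e by (auto simp: nw_def)
      ultimately show False using eT out[of "(i + 1, j + 1)"] e domI by (auto simp: nw_def)
    qed
    then show ?thesis using front_state[of D i j "insert p D" I] assms(2) pD domI closed_finite D e
      unfolding z_def by (auto simp: ideal_def)
  qed
  have before: "I ++ shifted D = (I ++ ?S)((i + 1, j + 1) \<mapsto> z)"
  proof -
    have "shifted D = ?S((i + 1, j + 1) \<mapsto> z)"
      using shifted_split[of i j D] eT(2,3) unfolding e z_def by blast
    then show ?thesis by (simp only: map_add_upd)
  qed
  have after: "(I ++ ?S)((a,b) \<mapsto> x) = I((a,b) \<mapsto> x) ++ ?S" if "nw (a - 1, b - 1) e" for a b x
    using S[OF that] by (simp add: map_add_upd_left)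
  show ?thesis
  proof (cases "p = e")
    case False
    \<comment> \<open>Otherwise \<open>e\<close>, being northwest of \<open>p\<close>, would belong
      to the ideal \<open>insert p D\<close>.\<close>
    have adj: "(i, j + 1) \<noteq> p" "(i + 1, j) \<noteq> p"
    proof -
      have "e \<notin> insert p D" using eT False by auto
      then have "\<not> nw e p" using idealD[OF pD(2), of p e] v e by auto
      then show "(i, j + 1) \<noteq> p" "(i + 1, j) \<noteq> p" using e by (auto simp: nw_def)
    qed
    have "slides (bulleted ((I ++ ?S)((i + 1, j + 1) \<mapsto> z))) = slides (bulleted ((I ++ ?S)((i,j) \<mapsto> z)))"
      by (rule slides_diagonal[OF front v])
        (use outI[of "(i, j + 1)"] outI[of "(i + 1, j)"] adj S[of i j] S[of i "j + 1"] S[of "i + 1" j]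
          eT domI e False in \<open>auto simp: nw_def\<close>)
    then have "slides (bulleted (oplus lam T y)) = slides (bulleted (I(e \<mapsto> z) ++ ?S))"
      using sl before after[of i j z] e by (simp add: nw_def)
    moreover have "ideal (insert p ?D)"
      using ideal_Un[OF D' pD(2)] by (simp add: insert_commute)
    ultimately have "stage ?D (I(e \<mapsto> z)) p"
      using ru False pD domI pT by (auto simp: stage_def)
    then show ?thesis by blast
  next
    case True
    define x where "x = the (I e)"
    have "e \<in> dom I" using domI True by simp
    then have Ie: "I e = Some x" by (auto simp: x_def)
    have xz: "key x < key z" using pT eT True by (simp add: x_def)
    have dI: "dom I = ?D" using domI True by simp
    define a where "a = bump_act e z"
    define z' where "z' = act_letter a"
    \<comment> \<open>The letter changes only if it is high and on the diagonal, and there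
      \<open>follows_diag_key\<close> gives a strict inequality.\<close>
    have z'D: "key t \<le> key z'" if "(T |` D) c = Some t" for c t
    proof (cases "is_high z \<and> i = j")
      case True
      then obtain k where k: "z = Hi k" by (metis is_high.elims(2))
      have "key t < key z"
        using follows_diag_key[of D i c] that True assms(2) eT e
        by (auto simp: restrict_map_def split: if_splits)
      then show ?thesis using k True e by (simp add: z'_def a_def bump_act_def)
    next
      case False
      then have "z' = z" using e by (cases z) (auto simp: z'_def a_def bump_act_def)
      then show ?thesis using Dz that by blast
    qed
    \<comment> \<open>Lowering costs one, which the strict inequality \<open>yz\<close> can
      spare.\<close>
    have "2 * y + 1 \<le> key z'"
      using yz by (cases z) (auto simp: z'_def a_def bump_act_def)
    then have bound: "key t \<le> key z'" if "I c = Some t" for c t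
      using runs_bound[OF runs, of "key z'"] that z'D by auto
    \<comment> \<open>Here \<open>q\<close> is the cell where the next insertion places
      \<open>z'\<close> and to which the slides carry it; the clause on \<open>key z'\<close> renews
      the strict inequality of \<open>stage\<close>.\<close>
    have "\<exists>q. on_line a q \<and> q \<notin> ?D \<and> ideal (insert q ?D) \<and>
      (q \<in> dom T \<longrightarrow> key z' < key (the (T q))) \<and>
      slides (bulleted (I ++ shifted D)) = slides (bulleted (I(q \<mapsto> z') ++ ?S))"
    proof (cases "is_high z \<and> i \<noteq> j")
      case True
      then have ij: "i < j" using v by (auto simp: valid_def)
      obtain k where k: "z = Hi k" using True by (metis is_high.elims(2))
      have a: "a = RowIns (i + 1) z" "z' = z"
        using True e by (auto simp: z'_def a_def bump_act_def)
      have nD: "(i + 1, j) \<notin> ?D" using out[of "(i + 1, j)"] e by (auto simp: nw_def)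
      obtain j2 where j2: "j2 \<le> j" "(i + 1, j2) \<in> valid" "(i + 1, j2) \<notin> ?D" "ideal (insert (i + 1, j2) ?D)"
        by (rule ideal_insert_row[OF D' _ nD]) (use ij v e in \<open>auto simp: valid_def\<close>)
      \<comment> \<open>Equal high letters are treated from west to east, but \<open>j2 \<le> j\<close>.\<close>
      have "key z < key (the (T (i + 1, j2)))" if q: "(i + 1, j2) \<in> dom T"
      proof -
        have lt: "rk e < rk (i + 1, j2)" using assms(2) q j2 by (auto simp: follows_def)
        then have le: "key z \<le> key (the (T (i + 1, j2)))" using key_le_rk[of e] by (simp add: z_def)
        have "the (T (i + 1, j2)) \<noteq> z"
        proof
          assume "the (T (i + 1, j2)) = z"
          then have q': "T (i + 1, j2) = Some (Hi k)" using q k by auto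
          then have "j \<le> j2" using lt eT k e by (auto simp: rk_def rank_def)
          then have "j2 = j" using j2 by simp
          then show False using col_high[of "i + 1" j k i] q' eT k e by simp
        qed
        then show ?thesis using le key_inject by (metis le_neq_implies_less)
      qed
      moreover have "slides (bulleted (I ++ shifted D)) = slides (bulleted (I((i + 1, j2) \<mapsto> z) ++ ?S))"
      proof -
        have free: "(i + 1, j') \<notin> dom (I ++ ?S)" if "j2 \<le> j'" "j' \<le> j" for j'
        proof -
          have "(i + 1, j') \<notin> ?D"
            using idealD[OF D' _ j2(2), of "(i + 1, j')"] j2(3) that by (auto simp: nw_def)
          then show ?thesis using S[of "i + 1" j'] that e dI by (auto simp: nw_def)
        qed
        have above: "(i + 1 - 1, j') \<in> dom (I ++ ?S)" if "j2 \<le> j'" "j' \<le> j" for j'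
          using idealD[OF D', of e "(i,j')"] that j2 v e dI by (auto simp: nw_def valid_def)
        \<comment> \<open>One (R2) slide to the left, then a run along row \<open>i + 1\<close> to
          its first free cell.\<close>
        have "slides (bulleted ((I ++ ?S)((i + 1, j + 1) \<mapsto> z))) = slides (bulleted ((I ++ ?S)((i + 1, j) \<mapsto> z)))"
        proof (rule slides_blocked_high[OF front v ij])
          show "(I ++ ?S) (i,j) = Some x" using Ie S[of i j] e
            by (auto simp: nw_def map_add_Some_iff)
          show "(i, j + 1) \<notin> dom (I ++ ?S)"
            using outI[of "(i, j + 1)"] S[of i "j + 1"] e \<open>p = e\<close> by (auto simp: nw_def)
        qed (use True xz free[of j] j2 in auto)
        also have "\<dots> = slides (bulleted ((I ++ ?S)((i + 1, j2) \<mapsto> z)))"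
          unfolding k
        proof (rule slides_left[OF j2(1) _ j2(2) free])
          show "front (I ++ ?S) (insert p D) (i + 1, j) (Hi k)"
            by (rule front_mono[OF front])
              (use free[of j] j2 ij v k in \<open>auto simp: valid_def rank_def\<close>)
        qed (use above in auto)
        finally show ?thesis using before after[of "i + 1" j2 z] j2 e by (simp add: nw_def)
      qed
      ultimately show ?thesis using a j2 by (intro exI[of _ "(i + 1, j2)"]) auto
    next
      case False
      have a: "a = ColIns (j + 1) z'" "z' = Lo (idx z)"
        using False e by (auto simp: z'_def a_def bump_act_def)
      have "i = j \<longrightarrow> is_high z" using diag_high[of i z] eT(1) e by auto
      then have low: "is_low z \<longleftrightarrow> i < j"
        using False v by (auto simp: is_low_def valid_def)
      have nD: "(i, j + 1) \<notin> ?D" using out[of "(i, j + 1)"] e by (auto simp: nw_def)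
      obtain i2 where i2: "i2 \<le> i" "(i2, j + 1) \<in> valid" "(i2, j + 1) \<notin> ?D" "ideal (insert (i2, j + 1) ?D)"
        by (rule ideal_insert_col[OF D' _ nD]) (use v e in \<open>auto simp: valid_def\<close>)
      \<comment> \<open>Equal low letters are treated from north to south, but \<open>i2 \<le> i\<close>.\<close>
      have "key z' < key (the (T (i2, j + 1)))" if q: "(i2, j + 1) \<in> dom T"
      proof -
        have lt: "rk e < rk (i2, j + 1)" using assms(2) q i2 by (auto simp: follows_def)
        then have le: "key z \<le> key (the (T (i2, j + 1)))" using key_le_rk[of e] by (simp add: z_def)
        show ?thesis
        proof (cases z)
          \<comment> \<open>Lowering turns the weak inequality into a strict one.\<close>
          case (Hi k)
          then show ?thesis using le a by simp
        next
          case (Lo k)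
          have "the (T (i2, j + 1)) \<noteq> z"
          proof
            assume "the (T (i2, j + 1)) = z"
            then have q': "T (i2, j + 1) = Some (Lo k)" using q Lo by auto
            then have "i \<le> i2" using lt eT Lo e by (auto simp: rk_def rank_def)
            then have "i2 = i" using i2 by simp
            then show False using row_low[of i "j + 1" k j] q' eT Lo e by simp
          qed
          then show ?thesis using le key_inject a Lo by (metis idx.simps(1) le_neq_implies_less)
        qed
      qed
      moreover have "slides (bulleted (I ++ shifted D)) = slides (bulleted (I((i2, j + 1) \<mapsto> z') ++ ?S))"
      proof -
        have free: "(i', j + 1) \<notin> dom (I ++ ?S)" if "i2 \<le> i'" "i' \<le> i" for i'
        proof -
          have "(i', j + 1) \<notin> ?D"
            using idealD[OF D' _ i2(2), of "(i', j + 1)"] i2(3) that by (auto simp: nw_def)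
          then show ?thesis using S[of i' "j + 1"] that e dI by (auto simp: nw_def)
        qed
        have left: "(i', j + 1 - 1) \<in> dom (I ++ ?S)" if "i2 \<le> i'" "i' \<le> i" for i'
          using idealD[OF D', of e "(i',j)"] that i2 v e dI by (auto simp: nw_def valid_def)
        \<comment> \<open>One slide up, lowering a letter that leaves the diagonal, then a run up
          column \<open>j + 1\<close>.\<close>
        have "slides (bulleted ((I ++ ?S)((i + 1, j + 1) \<mapsto> z))) =
          slides (bulleted ((I ++ ?S)((i, j + 1) \<mapsto> lower z)))"
        proof (rule slides_blocked_low[OF front v low])
          show "(I ++ ?S) (i,j) = Some x" using Ie S[of i j] e
            by (auto simp: nw_def map_add_Some_iff)
          show "(i + 1, j) \<notin> dom (I ++ ?S)"
            using outI[of "(i + 1, j)"] S[of "i + 1" j] e \<open>p = e\<close> by (auto simp: nw_def)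
        qed (use xz free[of i] i2 in auto)
        also have "\<dots> = slides (bulleted ((I ++ ?S)((i2, j + 1) \<mapsto> z')))"
          unfolding a lower_def
        proof (rule slides_up[OF i2(1) _ i2(2) _ free])
          have "rank (i, j + 1) (Lo (idx z)) \<le> rank (i + 1, j + 1) z"
            by (cases z) (auto simp: rank_def)
          then show "front (I ++ ?S) (insert p D) (i, j + 1) (Lo (idx z))"
            by (rule front_mono[OF front, rotated 2]) (use free[of i] i2 v in \<open>auto simp: valid_def\<close>)
        qed (use left v in \<open>auto simp: valid_def\<close>)
        finally show ?thesis using before after[of i2 "j + 1" z'] i2 e by (simp add: nw_def)
      qed
      ultimately show ?thesis using a i2 by (intro exI[of _ "(i2, j + 1)"]) auto
    qed
    then obtain q where q: "on_line a q" "q \<notin> ?D" "ideal (insert q ?D)"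
      "q \<in> dom T \<Longrightarrow> key z' < key (the (T q))"
      "slides (bulleted (I ++ shifted D)) = slides (bulleted (I(q \<mapsto> z') ++ ?S))" by blast
    \<comment> \<open>Nothing in \<open>I\<close> exceeds \<open>z'\<close>, so the continued
      insertion stops on the very next line.\<close>
    have "fits I a" using bound by (auto simp: fits_def z'_def)
    moreover have "q = line_end (dom I) a" using line_end_eqI[OF D' q(3,2,1)] dI by simp
    ultimately have "runs I a (I(q \<mapsto> z')) q" unfolding z'_def by (rule runs.place)
    then have "runs (T |` ?D) (RowIns 1 (Hi y)) (I(q \<mapsto> z')) q"
      using ru True xz by (simp add: a_def x_def)
    then have "stage ?D (I(q \<mapsto> z')) q" using q dI sl by (auto simp: stage_def)
    then show ?thesis by blast
  qed
qed

lemma stage_T: "\<exists>I p. stage (dom T) I p"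
proof (rule closed_induct[of "dom T" small])
  show "closed (dom T)" by (simp add: closed_def)
  show "small \<subseteq> dom T" by (auto simp: small_def)
  show "\<exists>I p. stage (insert e D) I p" if "small \<subseteq> D" "follows D e" "\<exists>I p. stage D I p" for D e
    using that stage_step by blast
qed (rule closed_small stage_small)+

section \<open>The start and the end of the rectification\<close>

lemma oplus_southeast:
  assumes "(a,b) \<in> valid" "(a,b) \<notin> dom (oplus lam T y)" "c \<in> dom (oplus lam T y)" "nw (a,b) c"
  shows "a = 1 \<and> b \<le> f"
proof -
  obtain i j where c: "c = (i,j)" by (cases c)
  have v: "1 \<le> a" "a \<le> b" using assms(1) by (auto simp: valid_def)
  have le: "a \<le> i" "b \<le> j" using assms(4) c by (auto simp: nw_def)
  have n: "(a,b) \<noteq> (1, f + 1)" using assms(2) by (auto simp: oplus_def)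
  show ?thesis
  proof (cases "c = (1, f + 1)")
    case True
    then show ?thesis using v le n c by auto
  next
    case False
    then have ij: "2 \<le> i" "2 \<le> j" "(i - 1, j - 1) \<in> dom T"
      using assms(3) c by (auto simp: oplus_def split: if_splits)
    show ?thesis
    proof (cases "a = 1")
      case True
      then show ?thesis using col_le_first[OF ij(3)] le n by auto
    next
      case False
      then have "(a - 1, b - 1) \<in> valid" "nw (a - 1, b - 1) (i - 1, j - 1)"
        using v le by (auto simp: valid_def nw_def)
      then have "(a - 1, b - 1) \<in> dom T" by (rule idealD[OF ideal_T ij(3)])
      then have "(a,b) \<in> dom (oplus lam T y)" using False v by (auto simp: oplus_def)
      then show ?thesis using assms(2) by simp
    qed
  qed
qed

text \<open>By \<open>oplus_southeast\<close> only cells of the inner shape can carry bullets, and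
  all of them do because \<open>Hi y\<close> lies to their east. If there are any, the first step of
  the loop places them and empties the list; otherwise the loop starts with
  \<open>[]\<close>.\<close>

lemma rect_mix_oplus: "rect_mix (oplus_inner lam) (oplus lam T y) =
  (case slides (bulleted (oplus lam T y)) of None \<Rightarrow> None
   | Some (mu, H) \<Rightarrow> if has_bullets H then None else Some (entry H))"
proof -
  let ?L = "oplus lam T y"
  let ?H = "\<lambda>c. map_option Ent (?L c)"
  have noB: "?H c \<noteq> Some Bul" for c by (cases "?L c") auto
  have start: "while_option rect_cond rect_step (oplus_inner lam, ?H) = slides (bulleted ?L)"
  proof (cases "f = 0")
    case True
    have "?H c = bulleted ?L c" for c
      using oplus_southeast[of "fst c" "snd c"] True
      by (cases c) (auto simp: bulleted_def valid_def split: option.splits)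
    then have "?H = bulleted ?L" by blast
    then show ?thesis using True by (simp add: oplus_inner_def)
  next
    case False
    have "clean (place_bullets [f] ?H) c = bulleted ?L c" for c
    proof -
      obtain a b where c: "c = (a,b)" by (cases c)
      let ?P = "place_bullets [f] ?H"
      have P: "?P c = (if a = 1 \<and> 1 \<le> b \<and> b \<le> f then Some Bul else ?H c)"
        using c by (auto simp: place_bullets_def)
      show ?thesis
      proof (cases "a = 1 \<and> 1 \<le> b \<and> b \<le> f")
        case True
        have y: "?L (1, f + 1) = Some (Hi y)" by (simp add: oplus_def)
        then have "isE ?P (1, f + 1)" by (simp add: isE_def entry_def place_bullets_def)
        moreover have "(1, f + 1) \<noteq> c" "fst c \<le> fst (1, f + 1)" "snd c \<le> snd (1, f + 1)"
          using True c by auto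
        ultimately have "\<exists>c'. c' \<noteq> c \<and> fst c \<le> fst c' \<and> snd c \<le> snd c' \<and> isE ?P c'" by metis
        then have "clean ?P c = ?P c" unfolding clean_def by (subst if_not_P) blast+
        then have "clean ?P c = Some Bul" using P True by simp
        moreover have "isB (bulleted ?L) c"
          unfolding isB_bulleted
        proof (intro conjI bexI[of _ "(1, f + 1)"])
          show "c \<notin> dom ?L" using True c by (auto simp: oplus_def)
        qed (use True c y in \<open>auto simp: valid_def nw_def\<close>)
        ultimately show ?thesis by (simp add: isB_def)
      next
        case False
        then have "clean ?P c = ?H c" using P noB unfolding clean_def by auto
        moreover have "\<not> isB (bulleted ?L) c"
          using oplus_southeast[of a b] False c by (auto simp: isB_bulleted valid_def)
        then have "bulleted ?L c = ?H c"
          by (auto simp: isB_def bulleted_def split: option.splits if_splits)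
        ultimately show ?thesis by simp
      qed
    qed
    then have "clean (place_bullets [f] ?H) = bulleted ?L" by blast
    moreover have "available ?H = (\<lambda>b. False)" using noB by (auto simp: available_def isB_def)
    moreover have "\<not> has_bullets ?H" using noB by (simp add: has_bullets_def)
    ultimately show ?thesis using False
      by (subst while_option_unfold) (simp add: rect_cond_def rect_step_def oplus_inner_def)
  qed
  show ?thesis unfolding rect_mix_def start ..
qed

text \<open>Once all cells are treated nothing remains in shifted position and the entries fill an
  ideal. Hence no bullet is left, and the slides stop at \<open>I\<close>, the result of the
  insertion.\<close>

lemma mixed_insert_eq_rect_mix:
  "mixed_insert T y \<noteq> None \<and> rect_mix (oplus_inner lam) (oplus lam T y) = mixed_insert T y"
proof -
  obtain I p where stage: "stage (dom T) I p" using stage_T by blast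
  have "T |` dom T = T" by (auto simp: restrict_map_def fun_eq_iff domIff)
  then have "runs T (RowIns 1 (Hi y)) I p" using stage by (simp add: stage_def)
  then have ins: "mixed_insert T y = Some I"
    using runs_while finite_T by (simp add: mixed_insert_def)
  have "shifted (dom T) c = None" for c
    by (cases "shifted (dom T) c") (auto elim: shiftedE)
  then have "I ++ shifted (dom T) = I" by (simp add: map_add_def fun_eq_iff)
  then have sl: "slides (bulleted (oplus lam T y)) = slides (bulleted I)"
    using stage by (simp add: stage_def)
  have I: "ideal (dom I)" using stage by (simp add: stage_def)
  have "\<not> available (bulleted I) c" for c
    using not_available_ideal[OF I order_refl, of c] by (auto simp: available_def isE_bulleted)
  then have "slides (bulleted I) = Some ([], bulleted I)"
    by (subst while_option_unfold) (simp add: rect_cond_def)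
  moreover have "\<not> isB (bulleted I) c" for c
    using idealD[OF I, of _ c] by (auto simp only: isB_bulleted)
  then have "\<not> has_bullets (bulleted I)" by (simp add: has_bullets_def isB_def)
  ultimately show ?thesis using ins sl by (simp add: rect_mix_oplus entry_bulleted)
qed

end

theorem theorem3p13:
  fixes lam :: "nat list" and T :: tab and y :: nat
  assumes "semistandard lam [] T"
    and "1 \<le> y"
    and "semistandard (oplus_outer lam) (oplus_inner lam) (oplus lam T y)"
  shows "mixed_insert T y \<noteq> None \<and> rect_mix (oplus_inner lam) (oplus lam T y) = mixed_insert T y"
proof -
  interpret insertion lam T y by (unfold_locales; fact assms)
  show ?thesis by (rule mixed_insert_eq_rect_mix)
qed

end
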